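(* Let $\zeta_n(z)=\sum_{N\lhd\mathcal{L}_n,\,[\mathcal{L}_n:N]<\infty}[\mathcal{L}_n:N]^{-z}$ be the zeta function counting normal subgroups of finite index of $\mathcal{L}_n$. Then (as Dirichlet series) $$\zeta_n(z)=\sum_{s\ge 1}s^{-z}\left[\prod_{\substack{r\in R\text{ prime},\ r\mid 1-x^s\\ r\ne 1-x}}\ \left(\sum_{\substack{M\in \mathrm{Mod}_r\\ (1-x^s)R^n\subset M}}[R^n:M]^{-z}\right)\right]\cdot\left(\sum_{\substack{M\in \mathrm{Mod}_{1-x}\\ (1-x^s)R^n\subset M}}\tau(M)\,[R^n:M]^{-z}\right),$$ where $\mathrm{Mod}_r$ is the set of all $R$-submodules $M$ of $R^n$ such that $r^kR^n\subset M$ for some $k$, and for $M\in\mathrm{Mod}_{1-x}$, $\tau(M)=|\ker\varphi|$ where $\varphi:R^n/M\to R^n/M$ is multiplication by $1-x$.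
   Context: $p$ is a fixed prime, $n\ge 1$, $R=\mathbb{F}_p[x,x^{-1}]$. $\mathcal{L}_n=(\mathbb{Z}/p\mathbb{Z})^n\wr\mathbb{Z}=\left(\bigoplus_{\mathbb{Z}}(\mathbb{Z}/p\mathbb{Z})^n\right)\rtimes\mathbb{Z}$, where the generator of $\mathbb{Z}$ acts by the shift by one. Primes $r$ of the principal ideal domain $R$ are taken up to units, e.g. each represented by the irreducible polynomial $r\in\mathbb{F}_p[x]$ with $r(0)=1$. *)

theory Defs
  imports
    "HOL-Analysis.Analysis"
    "HOL-Library.Poly_Mapping"
    "HOL-Library.Set_Algebras"
    "HOL-Algebra.Coset"
    "Berlekamp_Zassenhaus.Finite_Field"
begin

section \<open>Formal Dirichlet series\<close>

text \<open>The value of the function at \<open>m \<ge> 1\<close> is the coefficient of \<open>m\<^sup>-\<^sup>z\<close>.  There is no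
  term with \<open>m = 0\<close>, hence the normalisation.\<close>

typedef (overloaded) 'a dirichlet_series = "{f :: nat \<Rightarrow> 'a::zero. f 0 = 0}"
  morphisms ds_coeff Abs_ds
  by auto

setup_lifting type_definition_dirichlet_series

lemma ds_eqI: "(\<And>m. m > 0 \<Longrightarrow> ds_coeff F m = ds_coeff G m) \<Longrightarrow> F = G"
proof (transfer, rule ext)
  fix f g :: "nat \<Rightarrow> 'a" and m :: nat
  assume "f 0 = 0" "g 0 = 0" "\<And>m. 0 < m \<Longrightarrow> f m = g m"
  then show "f m = g m" by (cases m) auto
qed

instantiation dirichlet_series :: (comm_semiring_1) comm_semiring_1
begin

lift_definition zero_dirichlet_series :: "'a dirichlet_series" is "\<lambda>_. 0" by simp

lift_definition one_dirichlet_series :: "'a dirichlet_series"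
  is "\<lambda>m. if m = 1 then 1 else 0" by simp

lift_definition plus_dirichlet_series ::
    "'a dirichlet_series \<Rightarrow> 'a dirichlet_series \<Rightarrow> 'a dirichlet_series"
  is "\<lambda>f g m. f m + g m" by simp

lift_definition times_dirichlet_series ::
    "'a dirichlet_series \<Rightarrow> 'a dirichlet_series \<Rightarrow> 'a dirichlet_series"
  is "\<lambda>f g m. if m = 0 then 0 else \<Sum>(d, e)\<in>{(d, e). d * e = m}. f d * g e" by simp

instance
proof
  have fin: "finite {(d, e). d * e = m}" if "m > 0" for m :: nat
  proof (rule finite_subset)
    show "{(d, e). d * e = m} \<subseteq> {..m} \<times> {..m}" using that by (auto simp: Suc_le_eq)
  qed auto
  fix F G H :: "'a dirichlet_series"
  show "F + G + H = F + (G + H)" by transfer (simp add: add.assoc)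
  show "F + G = G + F" by transfer (simp add: add.commute)
  show "0 + F = F" by transfer simp
  show "0 * F = 0" by transfer (auto simp: fun_eq_iff)
  show "F * 0 = 0" by transfer (auto simp: fun_eq_iff)
  show "(0 :: 'a dirichlet_series) \<noteq> 1" by transfer (auto simp: fun_eq_iff)
  show "(F + G) * H = F * H + G * H"
    by transfer (auto simp: fun_eq_iff algebra_simps sum.distrib case_prod_unfold)
  show "F * G = G * F"
  proof (transfer, rule ext)
    fix f g :: "nat \<Rightarrow> 'a" and m :: nat
    have "(\<Sum>(d, e)\<in>{(d, e). d * e = m}. f d * g e) = (\<Sum>(d, e)\<in>{(d, e). d * e = m}. g d * f e)"
      by (rule sum.reindex_bij_witness[of _ prod.swap prod.swap]) (auto simp: mult.commute)
    then show "(if m = 0 then 0 else \<Sum>(d, e)\<in>{(d, e). d * e = m}. f d * g e)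
        = (if m = 0 then 0 else \<Sum>(d, e)\<in>{(d, e). d * e = m}. g d * f e)" by simp
  qed
  show "1 * F = F"
  proof (transfer, rule ext)
    fix f :: "nat \<Rightarrow> 'a" and m :: nat
    assume f0: "f 0 = 0"
    have "(\<Sum>(d, e)\<in>{(d, e). d * e = m}. (if d = 1 then 1 else 0) * f e) = f m" if "m > 0"
    proof -
      have "(\<Sum>(d, e)\<in>{(d, e). d * e = m}. (if d = 1 then 1 else 0) * f e)
          = (\<Sum>(d, e)\<in>{(1::nat, m)}. (if d = 1 then 1 else 0) * f e)"
        by (intro sum.mono_neutral_right fin that) (use that in \<open>auto split: if_splits\<close>)
      then show ?thesis by simp
    qed
    with f0 show "(if m = 0 then 0
        else \<Sum>(d, e)\<in>{(d, e). d * e = m}. (if d = 1 then 1 else 0) * f e) = f m" by simp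
  qed
  show "F * G * H = F * (G * H)"
  proof (transfer, rule ext)
    fix f g h :: "nat \<Rightarrow> 'a" and m :: nat
    let ?D = "\<lambda>m. {(d, e). d * e = (m::nat)}"
    let ?c = "\<lambda>f g m. if m = 0 then 0 else \<Sum>(d, e)\<in>?D m. f d * g e"
    show "?c (?c f g) h m = ?c f (?c g h) m"
    proof (cases "m = 0")
      case False
      have "(\<Sum>(d, e)\<in>?D m. ?c f g d * h e)
          = (\<Sum>(d, e)\<in>?D m. \<Sum>(a, b)\<in>?D d. f a * g b * h e)"
        using False by (intro sum.cong) (auto simp: sum_distrib_right case_prod_unfold)
      also have "\<dots> = (\<Sum>(p, q)\<in>(SIGMA p:?D m. ?D (fst p)). f (fst q) * g (snd q) * h (snd p))"
        using False by (subst sum.Sigma[symmetric]) (auto simp: fin fin[unfolded case_prod_unfold] case_prod_unfold)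
      also have "\<dots> = (\<Sum>(p, q)\<in>(SIGMA p:?D m. ?D (snd p)). f (fst p) * (g (fst q) * h (snd q)))"
        by (rule sum.reindex_bij_witness[of _
              "\<lambda>(p, q). ((fst p * fst q, snd q), (fst p, fst q))"
              "\<lambda>(p, q). ((fst q, snd q * snd p), (snd q, snd p))"]) (auto simp: mult.assoc)
      also have "\<dots> = (\<Sum>(d, e)\<in>?D m. \<Sum>(a, b)\<in>?D e. f d * (g a * h b))"
        using False by (subst sum.Sigma[symmetric]) (auto simp: fin fin[unfolded case_prod_unfold] case_prod_unfold)
      also have "\<dots> = (\<Sum>(d, e)\<in>?D m. f d * ?c g h e)"
        using False by (intro sum.cong) (auto simp: sum_distrib_left case_prod_unfold)
      finally show ?thesis using False by simp
    qed simp
  qed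
qed

end

text \<open>\<open>ds_term m\<close> is \<open>m\<^sup>-\<^sup>z\<close>.\<close>

lift_definition ds_term :: "nat \<Rightarrow> 'a::comm_semiring_1 dirichlet_series"
  is "\<lambda>m k. if k = m \<and> k \<noteq> 0 then 1 else 0" by simp

lemma ds_term_mult: "ds_term a * ds_term b = ds_term (a * b)"
proof (transfer fixing: a b, rule ext)
  fix m :: nat
  let ?t = "\<lambda>m k. if k = m \<and> k \<noteq> 0 then 1 else 0 :: 'a"
  have "(\<Sum>(d, e)\<in>{(d, e). d * e = m}. ?t a d * ?t b e) = ?t (a * b) m" if "m > 0"
  proof -
    have fin: "finite {(d, e). d * e = m}"
      by (rule finite_subset[of _ "{..m} \<times> {..m}"]) (use that in \<open>auto simp: Suc_le_eq\<close>)
    have "(\<Sum>(d, e)\<in>{(d, e). d * e = m}. ?t a d * ?t b e)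
        = (\<Sum>(d, e)\<in>{(d, e). d * e = m} \<inter> {(a, b)}. ?t a d * ?t b e)"
      by (intro sum.mono_neutral_right fin) (auto split: if_splits)
    then show ?thesis using that by (cases "a * b = m") auto
  qed
  then show "(if m = 0 then 0 else \<Sum>(d, e)\<in>{(d, e). d * e = m}. ?t a d * ?t b e) = ?t (a * b) m"
    by (cases "m > 0") simp_all
qed

text \<open>Sums of arbitrary families are formed coefficientwise; they exist if each \<open>m\<^sup>-\<^sup>z\<close> occurs
  in only finitely many members of the family.\<close>

definition ds_has_sum ::
    "('i \<Rightarrow> 'a::comm_semiring_1 dirichlet_series) \<Rightarrow> 'i set \<Rightarrow> 'a dirichlet_series \<Rightarrow> bool"
  where "ds_has_sum F I S \<longleftrightarrow>
    (\<forall>m. finite {i\<in>I. ds_coeff (F i) m \<noteq> 0} \<and>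
         ds_coeff S m = (\<Sum>i | i \<in> I \<and> ds_coeff (F i) m \<noteq> 0. ds_coeff (F i) m))"

definition ds_summable :: "('i \<Rightarrow> 'a::comm_semiring_1 dirichlet_series) \<Rightarrow> 'i set \<Rightarrow> bool"
  where "ds_summable F I \<longleftrightarrow> (\<exists>S. ds_has_sum F I S)"

definition ds_infsum ::
    "('i \<Rightarrow> 'a::comm_semiring_1 dirichlet_series) \<Rightarrow> 'i set \<Rightarrow> 'a dirichlet_series"
  where "ds_infsum F I = (THE S. ds_has_sum F I S)"

lemma ds_has_sum_unique: "ds_has_sum F I S \<Longrightarrow> ds_has_sum F I T \<Longrightarrow> S = T"
  by (rule ds_eqI) (simp add: ds_has_sum_def)

lemma ds_infsum_eqI: "ds_has_sum F I S \<Longrightarrow> ds_infsum F I = S"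
  unfolding ds_infsum_def by (blast intro: ds_has_sum_unique)

lemma ds_has_sum_infsum: "ds_summable F I \<Longrightarrow> ds_has_sum F I (ds_infsum F I)"
  unfolding ds_summable_def using ds_infsum_eqI by metis


section \<open>The zeta function of normal subgroups\<close>

definition group_index :: "('g, 'm) monoid_scheme \<Rightarrow> 'g set \<Rightarrow> nat"
  where "group_index G N = card (rcosets\<^bsub>G\<^esub> N)"

definition fin_index_normal :: "('g, 'm) monoid_scheme \<Rightarrow> 'g set set"
  where "fin_index_normal G = {N. N \<lhd> G \<and> finite (rcosets\<^bsub>G\<^esub> N)}"

definition normal_zeta :: "('g, 'm) monoid_scheme \<Rightarrow> nat dirichlet_series"
  where "normal_zeta G = ds_infsum (\<lambda>N. ds_term (group_index G N)) (fin_index_normal G)"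


section \<open>The lamplighter group\<close>

definition shift :: "int \<Rightarrow> (int \<Rightarrow>\<^sub>0 'a::zero) \<Rightarrow> (int \<Rightarrow>\<^sub>0 'a)"
  where "shift k f = Poly_Mapping.map_key (\<lambda>i. i - k) f"

lemma lookup_shift: "Poly_Mapping.lookup (shift k f) i = Poly_Mapping.lookup f (i - k)"
  by (simp add: shift_def map_key.rep_eq inj_on_def)

text \<open>The restricted wreath product of the additive group \<open>'a\<close> with the integers.\<close>

definition wreath_int :: "((int \<Rightarrow>\<^sub>0 'a::ab_group_add) \<times> int) monoid"
  where "wreath_int = \<lparr>carrier = UNIV,
    mult = (\<lambda>(f, k) (g, l). (f + shift k g, k + l)), one = (0, 0)\<rparr>"

lemma group_wreath_int: "group wreath_int"
proof (rule groupI)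
  fix x :: "(int \<Rightarrow>\<^sub>0 'a) \<times> int"
  obtain f k where x: "x = (f, k)" by fastforce
  have "(- shift (- k) f, - k) \<otimes>\<^bsub>wreath_int\<^esub> x = \<one>\<^bsub>wreath_int\<^esub>"
    by (simp add: x wreath_int_def)
  then show "\<exists>y\<in>carrier wreath_int. y \<otimes>\<^bsub>wreath_int\<^esub> x = \<one>\<^bsub>wreath_int\<^esub>"
    by (rule bexI) (simp add: wreath_int_def)
qed (auto simp: wreath_int_def lookup_shift lookup_add algebra_simps intro!: poly_mapping_eqI)

text \<open>Here \<open>p = CARD('p)\<close> and \<open>n = CARD('n)\<close>.\<close>

abbreviation lamplighter :: "((int \<Rightarrow>\<^sub>0 'p::prime_card mod_ring ^ 'n) \<times> int) monoid"
  where "lamplighter \<equiv> wreath_int"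


section \<open>Laurent polynomials and submodules of free modules over them\<close>

text \<open>The convolution product of \<open>int \<Rightarrow>\<^sub>0 'a\<close> makes it the ring of Laurent polynomials.\<close>

type_synonym 'a laurent_poly = "int \<Rightarrow>\<^sub>0 'a"

definition laurent_X :: "'a::comm_ring_1 laurent_poly"
  where "laurent_X = Poly_Mapping.single 1 1"

text \<open>Each prime is associated to exactly one prime that is a polynomial with constant
  coefficient 1, since the units are the \<open>c x\<^sup>k\<close> with \<open>c \<noteq> 0\<close>.\<close>

definition normalized_primes :: "'a::field laurent_poly set"
  where "normalized_primes =
    {r. prime_elem r \<and> Poly_Mapping.keys r \<subseteq> {0..} \<and> Poly_Mapping.lookup r 0 = 1}"

lemma module_vec: "Modules.module ((*s) :: 'a::comm_ring_1 \<Rightarrow> 'a ^ 'n \<Rightarrow> 'a ^ 'n)"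
  by unfold_locales (simp_all add: vec_eq_iff algebra_simps)

definition submodules :: "('a::comm_ring_1 ^ 'n) set set"
  where "submodules = {M. module.subspace (*s) M}"

definition Mod_at :: "'a::comm_ring_1 \<Rightarrow> ('a ^ 'n) set set"
  where "Mod_at r = {M \<in> submodules. \<exists>k::nat. range ((*s) (r ^ k)) \<subseteq> M}"

definition quot :: "('a::comm_ring_1 ^ 'n) set \<Rightarrow> ('a ^ 'n) set set"
  where "quot M = range (\<lambda>v. v +o M)"

definition mod_index :: "('a::comm_ring_1 ^ 'n) set \<Rightarrow> nat"
  where "mod_index M = card (quot M)"

definition quot_mult :: "('a::comm_ring_1 ^ 'n) set \<Rightarrow> 'a \<Rightarrow> ('a ^ 'n) set \<Rightarrow> ('a ^ 'n) set"
  where "quot_mult M a C = (\<Union>v\<in>C. (a *s v) +o M)"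

lemma quot_mult_coset:
  assumes "M \<in> submodules"
  shows "quot_mult M a (v +o M) = (a *s v) +o M"
proof -
  interpret Modules.module "(*s) :: 'a \<Rightarrow> 'a ^ 'n \<Rightarrow> 'a ^ 'n" by (rule module_vec)
  from assms have M: "subspace M" by (simp add: submodules_def)
  have "(a *s (v + w)) +o M = (a *s v) +o M" if "w \<in> M" for w
  proof -
    have "a *s w +o M = M"
    proof (intro equalityI subsetI)
      fix u assume "u \<in> M"
      then have "u - a *s w \<in> M" using M that by (blast intro: subspace_diff subspace_scale)
      then show "u \<in> a *s w +o M" by (force simp: elt_set_plus_def)
    qed (use M that in \<open>auto simp: elt_set_plus_def intro: subspace_add subspace_scale\<close>)
    then show ?thesis by (simp add: scale_right_distrib flip: set_plus_rearrange2)
  qed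
  moreover have "0 \<in> M" using M by (rule subspace_0)
  ultimately have "(\<Union>w\<in>M. (a *s (v + w)) +o M) = (a *s v) +o M" by auto
  moreover have "v +o M = (\<lambda>w. v + w) ` M" by (auto simp: elt_set_plus_def)
  ultimately show ?thesis by (simp only: quot_mult_def image_image)
qed

text \<open>The zero element of the quotient by \<open>M\<close> is \<open>M\<close> itself.\<close>

definition tau :: "('a::comm_ring_1 laurent_poly ^ 'n) set \<Rightarrow> nat"
  where "tau M = card {C \<in> quot M. quot_mult M (1 - laurent_X) C = M}"

end

theory Submission
  imports Defs
begin

text \<open>
  A normal subgroup \<open>N\<close> of finite index meets the base group \<open>R\<^sup>n\<close> in a submodule \<open>M\<close> and projects onto
  \<open>s\<int>\<close> for some \<open>s \<ge> 1\<close>; it is generated by \<open>M\<close> and one element \<open>(v, s)\<close>, where only the coset of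
  \<open>v\<close> modulo \<open>M\<close> matters.  Conjugation by the base group forces \<open>(1 - x\<^sup>s) R\<^sup>n \<subseteq> M\<close> and conjugation
  by the generator of \<open>\<int>\<close> forces \<open>(1 - x) v \<in> M\<close>, and these conditions suffice.  So each pair
  \<open>(s, M)\<close> comes from \<open>\<tau>(M)\<close> subgroups, all of index \<open>s [R\<^sup>n : M]\<close>.  For fixed \<open>s\<close>, the Chinese
  remainder theorem splits \<open>M\<close> into its components at the prime powers dividing \<open>1 - x\<^sup>s\<close>; the index
  and \<open>\<tau>\<close> are multiplicative, and \<open>\<tau> = 1\<close> away from \<open>1 - x\<close>.
\<close>

text \<open>Every submodule, at every prime, gets the same weight: \<open>tau M\<close> times the
  term of its index. The sum of this weight over the submodules containing
  \<open>(1 - x^s) R^n\<close> is the quantity in which both sides meet. On the group side it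
  counts, for fixed \<open>s\<close>, the pairs of \<open>M\<close> and a coset killed by
  \<open>1 - x\<close> in \<open>R^n / M\<close>; on the module side it is an Euler product once
  \<open>1 - x^s\<close> has been factored.

  Coprimality is stated as a Bezout identity \<open>u * b + v * c = 1\<close>, because its two
  summands act as the idempotents that split a module. Bezout identities and prime factors of
  Laurent polynomials come from division with remainder, with the spread of the exponents as
  Euclidean size.

  Two properties of the coefficients carry the group side. They are finite, so only finitely many
  \<open>M\<close> and cosets belong to each \<open>s\<close>; this matters because
  \<open>sum\<close> and \<open>card\<close> return 0 on infinite sets. And each one is an integer
  multiple of 1, so a subgroup of the base group that is stable under shifts is a submodule.\<close>

definition comaximal :: "'a::comm_ring_1 \<Rightarrow> 'a \<Rightarrow> bool"
  where "comaximal a b \<longleftrightarrow> (\<exists>u v. u * a + v * b = 1)"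

lemma comaximal_commute: "comaximal a b \<Longrightarrow> comaximal b a"
  unfolding comaximal_def by (metis add.commute)

lemma comaximal_one [simp]: "comaximal a 1"
  unfolding comaximal_def by (rule exI[of _ 0], rule exI[of _ 1]) simp

lemma comaximal_mult:
  assumes "comaximal a b" "comaximal a c"
  shows "comaximal a (b * c)"
proof -
  obtain u v s t where 1: "u * a + v * b = 1" and 2: "s * a + t * c = 1"
    using assms unfolding comaximal_def by blast
  have "(u * a + v * b) * (s * a + t * c) = 1" using 1 2 by simp
  then have "(u * s * a + u * t * c + v * b * s) * a + (v * t) * (b * c) = 1"
    by (simp add: algebra_simps)
  then show ?thesis unfolding comaximal_def by blast
qed

lemma comaximal_prod: "(\<And>i. i \<in> I \<Longrightarrow> comaximal a (f i)) \<Longrightarrow> comaximal a (prod f I)"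
  by (induction I rule: infinite_finite_induct) (auto intro: comaximal_mult)

lemma comaximal_power: "comaximal a b \<Longrightarrow> comaximal (a ^ i) (b ^ j)"
proof -
  have "comaximal a b \<Longrightarrow> comaximal a (b ^ j)" for a b :: 'a and j
    by (induction j) (auto intro: comaximal_mult)
  then show "comaximal a b \<Longrightarrow> comaximal (a ^ i) (b ^ j)"
    by (blast intro: comaximal_commute)
qed

section \<open>Laurent polynomials over a field\<close>

lemma lookup_mult_int:
  fixes f g :: "'a::comm_ring_1 laurent_poly"
  shows "Poly_Mapping.lookup (f * g) k =
    (\<Sum>l\<in>Poly_Mapping.keys f. Poly_Mapping.lookup f l * Poly_Mapping.lookup g (k - l))"
proof -
  have "Sum_any (\<lambda>q. Poly_Mapping.lookup g q when k = l + q) = Poly_Mapping.lookup g (k - l)" for l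
  proof -
    have "(\<lambda>q. Poly_Mapping.lookup g q when k = l + q) = (\<lambda>q. Poly_Mapping.lookup g q when q = k - l)"
      by (auto simp: fun_eq_iff when_def)
    then show ?thesis by (simp only: Sum_any_when_equal)
  qed
  then have "Poly_Mapping.lookup (f * g) k =
    Sum_any (\<lambda>l. Poly_Mapping.lookup f l * Poly_Mapping.lookup g (k - l))"
    by (simp add: lookup_mult)
  also have "\<dots> = (\<Sum>l\<in>Poly_Mapping.keys f. Poly_Mapping.lookup f l * Poly_Mapping.lookup g (k - l))"
    by (rule Sum_any.expand_superset) (auto simp: in_keys_iff)
  finally show ?thesis .
qed

lemma lookup_single_mult_int:
  fixes f :: "'a::comm_ring_1 laurent_poly"
  shows "Poly_Mapping.lookup (Poly_Mapping.single j c * f) k = c * Poly_Mapping.lookup f (k - j)"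
  by (cases "c = 0") (simp_all add: lookup_mult_int)

text \<open>A single summand of the convolution survives. This is meant for the extreme exponents,
  whose sum can be reached in only one way.\<close>

lemma lookup_mult_unique:
  fixes f g :: "'a::comm_ring_1 laurent_poly"
  assumes "\<And>i j. i \<in> Poly_Mapping.keys f \<Longrightarrow> j \<in> Poly_Mapping.keys g \<Longrightarrow> i + j = k + l \<Longrightarrow> i = k"
  shows "Poly_Mapping.lookup (f * g) (k + l) = Poly_Mapping.lookup f k * Poly_Mapping.lookup g l"
proof -
  have "Poly_Mapping.lookup (f * g) (k + l) =
      (\<Sum>i\<in>Poly_Mapping.keys f. if i = k then Poly_Mapping.lookup f k * Poly_Mapping.lookup g l else 0)"
    unfolding lookup_mult_int
  proof (rule sum.cong[OF refl])
    fix i assume i: "i \<in> Poly_Mapping.keys f"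
    show "Poly_Mapping.lookup f i * Poly_Mapping.lookup g (k + l - i) =
      (if i = k then Poly_Mapping.lookup f k * Poly_Mapping.lookup g l else 0)"
      using assms[OF i, of "k + l - i"] by (cases "i = k") (simp, force simp: in_keys_iff)
  qed
  also have "\<dots> = Poly_Mapping.lookup f k * Poly_Mapping.lookup g l"
    by (simp add: in_keys_iff)
  finally show ?thesis .
qed

section \<open>Width as a Euclidean size; division with remainder and Bezout identities\<close>

definition max_key :: "'a::zero laurent_poly \<Rightarrow> int"
  where "max_key f = Max (Poly_Mapping.keys f)"

definition min_key :: "'a::zero laurent_poly \<Rightarrow> int"
  where "min_key f = Min (Poly_Mapping.keys f)"

text \<open>Replaces the degree, which the units c x^k would change. The value at 0 is unspecified,
  hence the separate conditions on 0 below.\<close>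

definition width :: "'a::zero laurent_poly \<Rightarrow> nat"
  where "width f = nat (max_key f - min_key f)"

lemma keys_nonempty: "f \<noteq> 0 \<Longrightarrow> Poly_Mapping.keys f \<noteq> {}"
  by (metis empty_iff in_keys_iff lookup_zero poly_mapping_eqI)

lemma max_key_in: "f \<noteq> 0 \<Longrightarrow> max_key f \<in> Poly_Mapping.keys f"
  and min_key_in: "f \<noteq> 0 \<Longrightarrow> min_key f \<in> Poly_Mapping.keys f"
  unfolding max_key_def min_key_def by (simp_all add: keys_nonempty)

lemma key_bounds:
  assumes "k \<in> Poly_Mapping.keys f"
  shows "min_key f \<le> k" "k \<le> max_key f"
  unfolding max_key_def min_key_def using assms by auto

lemma max_min_key_eqI:
  assumes "\<And>k. k \<in> Poly_Mapping.keys f \<Longrightarrow> a \<le> k \<and> k \<le> b"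
    "a \<in> Poly_Mapping.keys f" "b \<in> Poly_Mapping.keys f"
  shows "min_key f = a" "max_key f = b"
  unfolding max_key_def min_key_def using assms by (auto intro!: Max_eqI Min_eqI)

text \<open>In a domain the product of two extreme coefficients is nonzero, and nothing else
  contributes at that exponent.\<close>

lemma max_min_key_mult:
  fixes f g :: "'a::idom laurent_poly"
  assumes "f \<noteq> 0" "g \<noteq> 0"
  shows "min_key (f * g) = min_key f + min_key g" "max_key (f * g) = max_key f + max_key g"
proof -
  have "Poly_Mapping.lookup (f * g) (min_key f + min_key g)
      = Poly_Mapping.lookup f (min_key f) * Poly_Mapping.lookup g (min_key g)"
    by (rule lookup_mult_unique) (force dest: key_bounds)
  then have 1: "min_key f + min_key g \<in> Poly_Mapping.keys (f * g)"
    using assms by (auto simp: in_keys_iff dest!: min_key_in)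
  have "Poly_Mapping.lookup (f * g) (max_key f + max_key g)
      = Poly_Mapping.lookup f (max_key f) * Poly_Mapping.lookup g (max_key g)"
    by (rule lookup_mult_unique) (force dest: key_bounds)
  then have 2: "max_key f + max_key g \<in> Poly_Mapping.keys (f * g)"
    using assms by (auto simp: in_keys_iff dest!: max_key_in)
  have "min_key f + min_key g \<le> k \<and> k \<le> max_key f + max_key g"
    if "k \<in> Poly_Mapping.keys (f * g)" for k
    using subsetD[OF keys_mult that] by (force dest: key_bounds)
  from max_min_key_eqI[OF this 1 2]
  show "min_key (f * g) = min_key f + min_key g" "max_key (f * g) = max_key f + max_key g"
    by simp_all
qed

lemma min_le_max_key: "f \<noteq> 0 \<Longrightarrow> min_key f \<le> max_key f"
  using key_bounds(1)[OF max_key_in] .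

lemma width_mult:
  fixes f g :: "'a::idom laurent_poly"
  assumes "f \<noteq> 0" "g \<noteq> 0"
  shows "width (f * g) = width f + width g"
  using assms min_le_max_key[of f] min_le_max_key[of g]
  unfolding width_def by (simp add: max_min_key_mult flip: nat_add_distrib)

lemma width_eq_0_imp_single:
  assumes "f \<noteq> 0" "width f = 0"
  shows "\<exists>k c. c \<noteq> 0 \<and> f = Poly_Mapping.single k c"
proof (intro exI conjI)
  have eq: "max_key f = min_key f"
    using assms min_le_max_key[of f] by (simp add: width_def)
  show "Poly_Mapping.lookup f (min_key f) \<noteq> 0"
    using min_key_in[OF assms(1)] by (simp add: in_keys_iff)
  show "f = Poly_Mapping.single (min_key f) (Poly_Mapping.lookup f (min_key f))"
  proof (rule poly_mapping_eqI)
    fix k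
    show "Poly_Mapping.lookup f k =
        Poly_Mapping.lookup (Poly_Mapping.single (min_key f) (Poly_Mapping.lookup f (min_key f))) k"
      using key_bounds[of k f] eq by (cases "k \<in> Poly_Mapping.keys f") (auto simp: lookup_single when_def in_keys_iff)
  qed
qed

lemma unit_mult_dvd:
  fixes u a b :: "'a::comm_ring_1"
  assumes "u dvd 1" "a dvd b"
  shows "u * a dvd b"
proof -
  from assms(1) obtain v where "1 = u * v" ..
  then have "b = (u * v) * b" by simp
  then have "b = u * (v * b)" by (simp add: mult.assoc)
  with assms(2) show ?thesis by (metis dvd_mult mult_dvd_mono dvd_refl)
qed

lemma single_dvd_one:
  fixes c :: "'a::field"
  assumes "c \<noteq> 0"
  shows "Poly_Mapping.single (k::int) c dvd 1"
proof
  show "1 = Poly_Mapping.single k c * Poly_Mapping.single (- k) (1 / c)"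
    using assms by (simp add: mult_single)
qed

lemma width_one: "width (1 :: 'a::comm_ring_1 laurent_poly) = 0"
  by (simp add: width_def max_key_def min_key_def)

lemma laurent_dvd_one_iff:
  fixes f :: "'a::field laurent_poly"
  shows "f dvd 1 \<longleftrightarrow> f \<noteq> 0 \<and> width f = 0"
proof
  assume "f dvd 1"
  then obtain g where g: "1 = f * g" ..
  then have "f \<noteq> 0" "g \<noteq> 0" by auto
  then show "f \<noteq> 0 \<and> width f = 0"
    using width_mult[of f g] by (simp add: g[symmetric] width_one)
next
  assume "f \<noteq> 0 \<and> width f = 0"
  then show "f dvd 1" using width_eq_0_imp_single[of f] single_dvd_one by blast
qed

lemma laurent_division:
  fixes f g :: "'a::field laurent_poly"
  assumes "g \<noteq> 0"
  shows "\<exists>q. f - q * g = 0 \<or> width (f - q * g) < width g"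
proof (induction "width f" arbitrary: f rule: less_induct)
  case less
  show ?case
  proof (cases "f = 0 \<or> width f < width g")
    case True
    then show ?thesis by (intro exI[of _ 0]) auto
  next
    case False
    define d where "d = max_key f - max_key g"
    define c where "c = Poly_Mapping.lookup f (max_key f) / Poly_Mapping.lookup g (max_key g)"
    define h where "h = f - Poly_Mapping.single d c * g"
    have fg: "width g \<le> width f" "f \<noteq> 0" using False by auto
    have lk: "Poly_Mapping.lookup h k = Poly_Mapping.lookup f k - c * Poly_Mapping.lookup g (k - d)" for k
      by (simp add: h_def lookup_minus lookup_single_mult_int)
    have "Poly_Mapping.lookup g (max_key g) \<noteq> 0"
      using max_key_in[OF assms] by (simp add: in_keys_iff)
    then have top: "Poly_Mapping.lookup h (max_key f) = 0"
      unfolding lk by (simp add: c_def d_def)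
    \<comment> \<open>With the tops aligned, \<open>width g \<le> width f\<close> keeps the shifted
      \<open>g\<close> from reaching below \<open>min_key f\<close>. So the remainder shrinks at the
      top without growing at the bottom.\<close>
    have bd: "min_key f \<le> k \<and> k < max_key f" if "k \<in> Poly_Mapping.keys h" for k
    proof -
      from that have "k \<in> Poly_Mapping.keys f \<or> k - d \<in> Poly_Mapping.keys g"
        by (auto simp: in_keys_iff lk)
      then have "min_key f \<le> k \<and> k \<le> max_key f"
        using key_bounds[of k f] key_bounds[of "k - d" g] fg min_le_max_key[OF assms] min_le_max_key[OF fg(2)]
        by (auto simp: d_def width_def)
      moreover have "k \<noteq> max_key f" using that top by (auto simp: in_keys_iff)
      ultimately show ?thesis by auto
    qed
    show ?thesis
    proof (cases "h = 0")
      case True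
      then show ?thesis unfolding h_def by blast
    next
      case False
      have "width h < width f"
        using bd[OF max_key_in[OF False]] bd[OF min_key_in[OF False]] by (simp add: width_def)
      from less[OF this] obtain q where "h - q * g = 0 \<or> width (h - q * g) < width g" ..
      then show ?thesis
        by (intro exI[of _ "q + Poly_Mapping.single d c"]) (simp add: h_def algebra_simps)
    qed
  qed
qed

text \<open>A nonzero combination of least width divides every combination: the remainder of the
  division is again a combination, of smaller width, so it must vanish.\<close>

lemma laurent_bezout:
  fixes a b :: "'a::field laurent_poly"
  shows "\<exists>g u v. g = u * a + v * b \<and> g dvd a \<and> g dvd b"
proof (cases "a = 0 \<and> b = 0")
  case True
  then show ?thesis by simp
next
  case False
  define I where "I = {g. g \<noteq> 0 \<and> (\<exists>u v. g = u * a + v * b)}"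
  have "a \<in> I \<or> b \<in> I"
    using False unfolding I_def by (auto intro: exI[of _ 0] exI[of _ 1])
  then obtain g where g: "g \<in> I" and min: "\<And>h. h \<in> I \<Longrightarrow> width g \<le> width h"
    using ex_has_least_nat[of "\<lambda>h. h \<in> I" _ width] by blast
  obtain u v where uv: "g = u * a + v * b" using g I_def by blast
  have dv: "g dvd s * a + t * b" for s t
  proof -
    obtain q where q: "s * a + t * b - q * g = 0 \<or> width (s * a + t * b - q * g) < width g"
      using laurent_division[of g "s * a + t * b"] g I_def by blast
    have "s * a + t * b - q * g = (s - q * u) * a + (t - q * v) * b"
      by (simp add: uv algebra_simps)
    then have "s * a + t * b - q * g = 0"
      using min[of "s * a + t * b - q * g"] q unfolding I_def by (metis (mono_tags, lifting) mem_Collect_eq not_le)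
    then show ?thesis by (simp add: dvd_def mult.commute)
  qed
  from dv[of 1 0] dv[of 0 1] uv show ?thesis by auto
qed

section \<open>Primes, their normal form and factorization\<close>

lemma laurent_irreducible_imp_prime:
  fixes p :: "'a::field laurent_poly"
  assumes "irreducible p"
  shows "prime_elem p"
proof (rule prime_elemI)
  show "p \<noteq> 0" "\<not> p dvd 1" using assms by (auto simp: irreducible_def)
  fix a b assume ab: "p dvd a * b"
  obtain g u v where g: "g = u * p + v * a" "g dvd p" "g dvd a"
    using laurent_bezout by blast
  from g(2) obtain h where h: "p = g * h" ..
  \<comment> \<open>If \<open>g\<close> is a unit, multiplying its Bezout identity by
    \<open>b\<close> exhibits \<open>b\<close> as a multiple of \<open>p\<close>. Otherwise
    \<open>g\<close> is an associate of \<open>p\<close> that divides \<open>a\<close>.\<close>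
  show "p dvd a \<or> p dvd b"
  proof (cases "g dvd 1")
    case True
    then obtain w where "1 = g * w" ..
    then have "b = w * u * b * p + w * v * (a * b)"
      unfolding g(1) by (metis (no_types, lifting) distrib_left mult.assoc mult.commute mult.right_neutral)
    then have "p dvd b" by (metis ab dvd_add dvd_mult dvd_triv_right)
    then show ?thesis ..
  next
    case False
    then have "h dvd 1" using assms h by (auto simp: irreducible_def)
    then have "p dvd g" using h by (metis dvd_refl mult.commute unit_mult_dvd)
    then show ?thesis using g(3) dvd_trans by blast
  qed
qed

text \<open>Dividing by the lowest term of \<open>p\<close>, which is a unit, moves the lowest
  exponent to 0 and makes its coefficient 1.\<close>

lemma laurent_unit_times_normalized:
  fixes p :: "'a::field laurent_poly"
  assumes "prime_elem p"
  shows "\<exists>u r. u dvd 1 \<and> r \<in> normalized_primes \<and> p = u * r"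
proof -
  have p0: "p \<noteq> 0" using assms by (simp add: prime_elem_def)
  define k where "k = min_key p"
  define c where "c = Poly_Mapping.lookup p k"
  have c0: "c \<noteq> 0" using min_key_in[OF p0] by (simp add: c_def k_def in_keys_iff)
  define r where "r = Poly_Mapping.single (- k) (1 / c) * p"
  have p: "p = Poly_Mapping.single k c * r"
    using c0 by (simp add: r_def mult_single flip: mult.assoc)
  have lk: "Poly_Mapping.lookup r i = Poly_Mapping.lookup p (i + k) / c" for i
    by (simp add: r_def lookup_single_mult_int)
  have "prime_elem r"
  proof -
    have "r dvd x \<longleftrightarrow> p dvd x" for x
    proof
      show "r dvd x \<Longrightarrow> p dvd x"
        using p single_dvd_one[OF c0] unit_mult_dvd by metis
      show "p dvd x \<Longrightarrow> r dvd x" using p dvd_mult_right by metis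
    qed
    moreover have "r \<noteq> 0" using p p0 by auto
    ultimately show ?thesis using assms by (simp add: prime_elem_def)
  qed
  moreover have "Poly_Mapping.lookup r 0 = 1" using c0 by (simp add: lk c_def)
  moreover have "Poly_Mapping.keys r \<subseteq> {0..}"
  proof
    fix i assume "i \<in> Poly_Mapping.keys r"
    then have "i + k \<in> Poly_Mapping.keys p" by (auto simp: in_keys_iff lk)
    then show "i \<in> {0..}" using key_bounds(1)[of "i + k" p] by (simp add: k_def)
  qed
  ultimately show ?thesis
    using p single_dvd_one[OF c0] unfolding normalized_primes_def by blast
qed

text \<open>A nonunit divisor of least width is irreducible: by additivity of the width, a nonunit
  factor of it leaves only width 0 for the cofactor.\<close>

lemma laurent_exists_prime_divisor:
  fixes a :: "'a::field laurent_poly"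
  assumes "a \<noteq> 0" "\<not> a dvd 1"
  shows "\<exists>p. prime_elem p \<and> p dvd a"
proof -
  obtain p where p: "\<not> p dvd 1 \<and> p dvd a" 
    and min: "\<And>h. \<not> h dvd 1 \<and> h dvd a \<Longrightarrow> width p \<le> width h"
    using ex_has_least_nat[of "\<lambda>h. \<not> h dvd 1 \<and> h dvd a" a width] assms by auto
  have p0: "p \<noteq> 0" using p assms by auto
  have "irreducible p"
  proof (rule irreducibleI)
    fix b c assume bc: "p = b * c"
    show "b dvd 1 \<or> c dvd 1"
    proof (rule ccontr)
      assume n: "\<not> (b dvd 1 \<or> c dvd 1)"
      have "b \<noteq> 0" "c \<noteq> 0" using p0 bc by auto
      moreover have "width p \<le> width b"
        using n p bc by (intro min) (auto intro: dvd_trans)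
      ultimately have "width c = 0" using width_mult[of b c] bc by simp
      then show False using n \<open>c \<noteq> 0\<close> by (simp add: laurent_dvd_one_iff)
    qed
  qed (use p p0 in auto)
  then show ?thesis using p laurent_irreducible_imp_prime by blast
qed

lemma laurent_factorization:
  fixes a :: "'a::field laurent_poly"
  assumes "a \<noteq> 0"
  shows "\<exists>u A. u dvd 1 \<and> set_mset A \<subseteq> normalized_primes \<and> a = u * prod_mset A"
  using assms
proof (induction "width a" arbitrary: a rule: less_induct)
  case less
  show ?case
  proof (cases "a dvd 1")
    case True
    then show ?thesis by (intro exI[of _ a] exI[of _ "{#}"]) simp
  next
    case False
    then obtain p where "prime_elem p" "p dvd a"
      using laurent_exists_prime_divisor less.prems by blast
    then obtain u r where ur: "u dvd 1" "r \<in> normalized_primes" "p = u * r"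
      using laurent_unit_times_normalized by blast
    then obtain b where b: "a = r * b" using \<open>p dvd a\<close> by (metis dvd_def dvd_mult_right)
    have 0: "b \<noteq> 0" "r \<noteq> 0" using b less.prems by auto
    have "\<not> r dvd 1" using ur(2) by (auto simp: normalized_primes_def prime_elem_def)
    then have "width b < width a"
      using 0 width_mult[of r b] b by (simp add: laurent_dvd_one_iff)
    from less.hyps[OF this 0(1)] obtain v A where
      "v dvd 1" "set_mset A \<subseteq> normalized_primes" "b = v * prod_mset A" by blast
    then show ?thesis using ur(2) b
      by (intro exI[of _ v] exI[of _ "add_mset r A"]) (auto simp: mult_ac)
  qed
qed

lemma normalized_primes_dvd_imp_eq:
  fixes r r' :: "'a::field laurent_poly"
  assumes r: "r \<in> normalized_primes" and r': "r' \<in> normalized_primes" and "r dvd r'"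
  shows "r = r'"
proof -
  from \<open>r dvd r'\<close> obtain u where u: "r' = r * u" ..
  have "\<not> r dvd 1" "irreducible r'"
    using r r' prime_elem_imp_irreducible by (auto simp: normalized_primes_def prime_elem_def)
  then have "u dvd 1" using u by (auto simp: irreducible_def)
  then obtain k c where kc: "u = Poly_Mapping.single k c"
    using width_eq_0_imp_single[of u] by (auto simp: laurent_dvd_one_iff)
  have lk: "Poly_Mapping.lookup r' i = c * Poly_Mapping.lookup r (i - k)" for i
    by (simp add: u kc lookup_single_mult_int mult.commute[of r])
  have neg: "Poly_Mapping.lookup f i = 0" if "f \<in> normalized_primes" "i < 0" for f :: "'a laurent_poly" and i
  proof (rule ccontr)
    assume "Poly_Mapping.lookup f i \<noteq> 0"
    then have "i \<in> Poly_Mapping.keys f" by (simp add: in_keys_iff)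
    then show False using that by (auto simp: normalized_primes_def)
  qed
  have 1: "Poly_Mapping.lookup r 0 = 1" "Poly_Mapping.lookup r' 0 = 1"
    using r r' by (simp_all add: normalized_primes_def)
  then have c: "c \<noteq> 0" using lk[of 0] by auto
  \<comment> \<open>The coefficient 1 of \<open>r'\<close> at 0 comes from a nonzero one of
    \<open>r\<close> at \<open>- k\<close>, and the coefficient 1 of \<open>r\<close> at 0 yields a
    nonzero one of \<open>r'\<close> at \<open>k\<close>. Neither has negative exponents.\<close>
  have "k \<le> 0" using lk[of 0] 1 neg[OF r, of "- k"] by fastforce
  moreover have "k \<ge> 0" using lk[of k] 1 c neg[OF r', of k] by fastforce
  ultimately have "k = 0" by simp
  with lk[of 0] 1 have "c = 1" by simp
  with \<open>k = 0\<close> show ?thesis by (simp add: u kc)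
qed

lemma normalized_primes_comaximal:
  fixes r r' :: "'a::field laurent_poly"
  assumes r: "r \<in> normalized_primes" and r': "r' \<in> normalized_primes" and "r \<noteq> r'"
  shows "comaximal r r'"
proof -
  obtain g u v where g: "g = u * r + v * r'" "g dvd r" "g dvd r'"
    using laurent_bezout by blast
  from g(2) obtain h where h: "r = g * h" ..
  have "g dvd 1"
  proof (rule ccontr)
    assume "\<not> g dvd 1"
    moreover have "irreducible r"
      using r prime_elem_imp_irreducible by (auto simp: normalized_primes_def)
    ultimately have "h dvd 1" using h by (auto simp: irreducible_def)
    then have "r dvd g" using h by (metis dvd_refl mult.commute unit_mult_dvd)
    then show False using g(3) dvd_trans normalized_primes_dvd_imp_eq assms by blast
  qed
  then obtain w where "1 = g * w" ..
  then have "(w * u) * r + (w * v) * r' = 1" by (simp add: g(1) algebra_simps)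
  then show ?thesis unfolding comaximal_def by blast
qed

section \<open>The elements \<open>1 - x^s\<close> and reduction modulo them\<close>

lemma laurent_X_power: "laurent_X ^ n = Poly_Mapping.single (int n) 1"
  by (induction n) (simp_all add: laurent_X_def mult_single)

lemma lookup_one_minus_single:
  "Poly_Mapping.lookup (1 - Poly_Mapping.single m 1 :: 'a::comm_ring_1 laurent_poly) i
    = (if i = 0 then 1 else 0) - (if i = m then 1 else 0)"
  by (simp add: lookup_minus lookup_one lookup_single when_def)

lemma one_minus_single_nonzero:
  assumes "m \<noteq> 0"
  shows "1 - Poly_Mapping.single m 1 \<noteq> (0 :: 'a::comm_ring_1 laurent_poly)"
proof
  assume "1 - Poly_Mapping.single m 1 = (0 :: 'a laurent_poly)"
  then have "Poly_Mapping.lookup (1 - Poly_Mapping.single m 1 :: 'a laurent_poly) 0 = 0" by simp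
  then show False using assms by (simp add: lookup_one_minus_single)
qed

text \<open>Its width is 1, so in any factorization one factor has width 0 and is a unit.\<close>

lemma one_minus_laurent_X_normalized:
  "1 - laurent_X \<in> (normalized_primes :: 'a::field laurent_poly set)"
proof -
  define e :: "'a laurent_poly" where "e = 1 - laurent_X"
  have lk: "Poly_Mapping.lookup e i = (if i = 0 then 1 else 0) - (if i = 1 then 1 else 0)" for i
    by (simp add: e_def laurent_X_def lookup_one_minus_single)
  have keys: "Poly_Mapping.keys e = {0, 1}"
    by (auto simp: in_keys_iff lk split: if_splits)
  have e0: "e \<noteq> 0" using keys by auto
  have w: "width e = 1" by (simp add: width_def max_key_def min_key_def keys)
  have "irreducible e"
  proof (rule irreducibleI)
    fix b c assume bc: "e = b * c"
    then have "b \<noteq> 0" "c \<noteq> 0" using e0 by auto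
    with bc w width_mult[of b c] show "b dvd 1 \<or> c dvd 1"
      by (auto simp: laurent_dvd_one_iff)
  qed (use e0 w in \<open>auto simp: laurent_dvd_one_iff\<close>)
  then show ?thesis
    using laurent_irreducible_imp_prime keys lk[of 0]
    unfolding normalized_primes_def e_def[symmetric] by auto
qed

text \<open>For \<open>j \<ge> 0\<close> by telescoping; a negative \<open>j\<close> is reduced to
  \<open>- j\<close> by pulling out the unit \<open>- x^(j s)\<close>.\<close>

lemma one_minus_single_dvd:
  fixes s j :: int
  shows "1 - Poly_Mapping.single s 1 dvd (1 - Poly_Mapping.single (j * s) 1 :: 'a::comm_ring_1 laurent_poly)"
proof -
  have nat: "1 - Poly_Mapping.single s 1 dvd (1 - Poly_Mapping.single (int i * s) 1 :: 'a laurent_poly)" for i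
  proof (induction i)
    case (Suc i)
    have "1 - Poly_Mapping.single (int (Suc i) * s) 1 =
        (1 - Poly_Mapping.single s 1) + Poly_Mapping.single s 1 *
          (1 - Poly_Mapping.single (int i * s) (1::'a))"
      by (simp add: algebra_simps mult_single)
    then show ?case using Suc by (metis dvd_add dvd_mult dvd_refl)
  qed simp
  show ?thesis
  proof (cases "j \<ge> 0")
    case True
    then show ?thesis using nat[of "nat j"] by simp
  next
    case False
    have "1 - Poly_Mapping.single (j * s) 1 =
        - Poly_Mapping.single (j * s) 1 * (1 - Poly_Mapping.single (int (nat (- j)) * s) (1::'a))"
      using False by (simp add: algebra_simps mult_single)
    then show ?thesis using nat[of "nat (- j)"] by (metis dvd_mult)
  qed
qed

lemma laurent_induct [case_names single add]:
  fixes f :: "'a::comm_ring_1 laurent_poly"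
  assumes single: "\<And>k c. P (Poly_Mapping.single k c)"
    and add: "\<And>f g. P f \<Longrightarrow> P g \<Longrightarrow> P (f + g)"
  shows "P f"
proof -
  have "P f" if "finite K" "Poly_Mapping.keys f \<subseteq> K" for f K
    using that
  proof (induction K arbitrary: f rule: finite_induct)
    case empty
    then have "f = Poly_Mapping.single 0 0" using keys_nonempty[of f] by auto
    then show ?case using single by metis
  next
    case (insert k K)
    define g where "g = f - Poly_Mapping.single k (Poly_Mapping.lookup f k)"
    have "Poly_Mapping.keys g \<subseteq> K"
    proof
      fix i assume "i \<in> Poly_Mapping.keys g"
      then have "i \<noteq> k \<and> i \<in> Poly_Mapping.keys f"
        by (cases "i = k") (auto simp: g_def in_keys_iff lookup_minus lookup_single)
      then show "i \<in> K" using insert.prems by auto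
    qed
    then have "P g" by (rule insert.IH)
    then have "P (g + Poly_Mapping.single k (Poly_Mapping.lookup f k))" using single add by blast
    then show ?case by (simp add: g_def)
  qed
  then show ?thesis using finite_keys by blast
qed

text \<open>Modulo \<open>1 - x^s\<close> exponents matter only modulo \<open>s\<close>, so each
  monomial can be moved into the window of length \<open>s\<close>.\<close>

lemma laurent_reduce_mod:
  fixes f :: "'a::comm_ring_1 laurent_poly"
  assumes "s > 0"
  shows "\<exists>d. Poly_Mapping.keys d \<subseteq> {0..<s} \<and> 1 - Poly_Mapping.single s 1 dvd f - d"
proof (induction f rule: laurent_induct)
  case (single k c)
  have "Poly_Mapping.single k c - Poly_Mapping.single (k mod s) c =
      - Poly_Mapping.single (k mod s) c * (1 - Poly_Mapping.single (k div s * s) 1)"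
    by (simp add: algebra_simps mult_single)
  then have "1 - Poly_Mapping.single s 1 dvd Poly_Mapping.single k c - Poly_Mapping.single (k mod s) c"
    using one_minus_single_dvd[of s "k div s"] by (metis dvd_mult)
  moreover have "Poly_Mapping.keys (Poly_Mapping.single (k mod s) c) \<subseteq> {0..<s}"
    using assms by simp
  ultimately show ?case by blast
next
  case (add f g)
  then obtain d e where *: "Poly_Mapping.keys d \<subseteq> {0..<s}" "1 - Poly_Mapping.single s 1 dvd f - d"
    "Poly_Mapping.keys e \<subseteq> {0..<s}" "1 - Poly_Mapping.single s 1 dvd g - e" by blast
  have "f + g - (d + e) = (f - d) + (g - e)" by simp
  then have "1 - Poly_Mapping.single s 1 dvd f + g - (d + e)" using * by (metis dvd_add)
  moreover have "Poly_Mapping.keys (d + e) \<subseteq> {0..<s}" using * keys_add[of d e] by blast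
  ultimately show ?case by blast
qed

section \<open>Submodules of finite free modules\<close>

text \<open>Both images are \<open>A\<close> modulo the same equivalence relation. This compares
  sets of cosets by their equality criteria alone, so that no map between quotients has to be shown
  well defined.\<close>

lemma bij_betw_same_kernel:
  assumes "\<And>x y. x \<in> A \<Longrightarrow> y \<in> A \<Longrightarrow> f x = f y \<longleftrightarrow> g x = g y"
  shows "\<exists>h. bij_betw h (f ` A) (g ` A)"
proof -
  define h where "h z = g (inv_into A f z)" for z
  have "h (f x) = g x" if "x \<in> A" for x
    unfolding h_def using that assms by (metis f_inv_into_f imageI inv_into_into)
  then have "bij_betw h (f ` A) (g ` A)"
    using assms by (auto simp: bij_betw_def inj_on_def image_iff)
  then show ?thesis by blast
qed

lemma card_image_same_kernel:
  assumes "\<And>x y. x \<in> A \<Longrightarrow> y \<in> A \<Longrightarrow> f x = f y \<longleftrightarrow> g x = g y"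
  shows "card (f ` A) = card (g ` A)"
  using bij_betw_same_kernel[of A f g, OF assms] bij_betw_same_card by blast

lemma finite_image_same_kernel:
  assumes "\<And>x y. x \<in> A \<Longrightarrow> y \<in> A \<Longrightarrow> f x = f y \<longleftrightarrow> g x = g y"
  shows "finite (f ` A) \<longleftrightarrow> finite (g ` A)"
  using bij_betw_same_kernel[of A f g, OF assms] bij_betw_finite by blast

lemma submodules_iff:
  "M \<in> submodules \<longleftrightarrow> 0 \<in> M \<and> (\<forall>v\<in>M. \<forall>w\<in>M. v + w \<in> M) \<and> (\<forall>c. \<forall>v\<in>M. c *s v \<in> M)"
  unfolding submodules_def by (auto simp: module.subspace_def[OF module_vec])

lemma submodule_0: "M \<in> submodules \<Longrightarrow> 0 \<in> M"
  and submodule_add: "M \<in> submodules \<Longrightarrow> v \<in> M \<Longrightarrow> w \<in> M \<Longrightarrow> v + w \<in> M"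
  and submodule_scale: "M \<in> submodules \<Longrightarrow> v \<in> M \<Longrightarrow> c *s v \<in> M"
  by (auto simp: submodules_iff)

lemma vector_smult_minus1: "(- 1) *s v = - (v :: 'a::comm_ring_1 ^ 'n)"
  by (simp add: vec_eq_iff)

lemma submodule_uminus: "M \<in> submodules \<Longrightarrow> v \<in> M \<Longrightarrow> - v \<in> M"
  using submodule_scale[of M v "- 1"] by (simp add: vector_smult_minus1)

lemma submodule_diff: "M \<in> submodules \<Longrightarrow> v \<in> M \<Longrightarrow> w \<in> M \<Longrightarrow> v - w \<in> M"
  using submodule_add[of M v "- w"] submodule_uminus[of M w] by simp

lemma submodule_diff_commute:
  assumes "M \<in> submodules"
  shows "v - w \<in> M \<longleftrightarrow> w - v \<in> M"
  using submodule_uminus[OF assms, of "v - w"] submodule_uminus[OF assms, of "w - v"] by auto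

lemma mem_coset_iff: "w \<in> v +o M \<longleftrightarrow> w - v \<in> M" for v w :: "'a::ab_group_add"
  unfolding elt_set_plus_def by (auto simp: algebra_simps intro: bexI[of _ "w - v"])

lemma coset_eq_iff:
  assumes M: "M \<in> submodules"
  shows "v +o M = w +o M \<longleftrightarrow> v - w \<in> M"
proof
  assume "v +o M = w +o M"
  moreover have "v \<in> v +o M" using submodule_0[OF M] by (simp add: mem_coset_iff)
  ultimately show "v - w \<in> M" by (simp add: mem_coset_iff)
next
  assume vw: "v - w \<in> M"
  show "v +o M = w +o M"
  proof (rule Set.set_eqI)
    fix u
    have "u - w \<in> M" if "u - v \<in> M"
    proof -
      have "(u - v) + (v - w) \<in> M" using M that vw by (rule submodule_add)
      moreover have "(u - v) + (v - w) = u - w" by (simp only: diff_add_cancel add_diff_eq)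
      ultimately show ?thesis by (simp only:)
    qed
    moreover have "u - v \<in> M" if "u - w \<in> M"
    proof -
      have "(u - w) - (v - w) \<in> M" using M that vw by (rule submodule_diff)
      moreover have "(u - w) - (v - w) = u - v" by (simp only: diff_diff_eq2 diff_add_cancel)
      ultimately show ?thesis by (simp only:)
    qed
    ultimately show "u \<in> v +o M \<longleftrightarrow> u \<in> w +o M" by (auto simp: mem_coset_iff)
  qed
qed

lemma coset_eq_self_iff: "M \<in> submodules \<Longrightarrow> v +o M = M \<longleftrightarrow> v \<in> M"
  using coset_eq_iff[of M v 0] by simp

text \<open>The quotient \<open>K / M\<close>, used with \<open>M \<subseteq> K\<close>. Taking
  \<open>K\<close> to be everything gives the index, and taking the preimage of the kernel of
  \<open>1 - x\<close> gives \<open>tau\<close>, so one counting argument serves both.\<close>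

definition cosets :: "('a::comm_ring_1 ^ 'n) set \<Rightarrow> ('a ^ 'n) set \<Rightarrow> ('a ^ 'n) set set"
  where "cosets K M = (\<lambda>v. v +o M) ` K"

lemma mod_index_eq: "mod_index M = card (cosets UNIV M)"
  by (simp add: mod_index_def quot_def cosets_def)

lemma quot_mult_kernel:
  assumes "M \<in> submodules"
  shows "{C \<in> quot M. quot_mult M a C = M} = cosets {v. a *s v \<in> M} M"
proof -
  have "quot_mult M a (v +o M) = M \<longleftrightarrow> a *s v \<in> M" for v
    by (simp add: quot_mult_coset[OF assms] coset_eq_self_iff[OF assms])
  then show ?thesis by (auto simp: quot_def cosets_def)
qed

lemma tau_eq: "M \<in> submodules \<Longrightarrow> tau M = card (cosets {v. (1 - laurent_X) *s v \<in> M} M)"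
  by (simp add: tau_def quot_mult_kernel)

section \<open>The Chinese remainder theorem for submodules\<close>

definition submodules_above :: "'a::comm_ring_1 \<Rightarrow> ('a ^ 'n) set set"
  where "submodules_above a = {M \<in> submodules. range ((*s) a) \<subseteq> M}"

lemma submodules_above_iff:
  "M \<in> submodules_above a \<longleftrightarrow> M \<in> submodules \<and> (\<forall>v. a *s v \<in> M)"
  by (auto simp: submodules_above_def)

lemma submodules_above_one: "submodules_above 1 = {UNIV}"
  by (auto simp: submodules_above_iff submodules_iff)

lemma submodules_above_dvd:
  assumes "a dvd b"
  shows "submodules_above a \<subseteq> submodules_above b"
proof
  from assms obtain c where b: "b = a * c" ..
  fix M :: "('a ^ 'n) set" assume "M \<in> submodules_above a"
  then show "M \<in> submodules_above b"
    by (simp add: submodules_above_iff b flip: vector_smult_assoc)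
qed

lemma comaximal_split:
  fixes w :: "'a::comm_ring_1 ^ 'n"
  assumes "u * b + v * c = 1"
  shows "(u * b) *s w + (v * c) *s w = w"
proof -
  have "(u * b) *s w + (v * c) *s w = (u * b + v * c) *s w"
    by (simp only: vector_sadd_rdistrib)
  then show ?thesis by (simp add: assms)
qed

lemma submodules_above_inter:
  assumes "M \<in> submodules_above b" "N \<in> submodules_above c"
  shows "M \<inter> N \<in> submodules_above (b * c)"
proof -
  have "M \<in> submodules_above (b * c)" "N \<in> submodules_above (b * c)"
    using assms submodules_above_dvd[of b "b * c"] submodules_above_dvd[of c "b * c"] by auto
  then show ?thesis by (auto simp: submodules_above_iff submodules_iff)
qed

text \<open>Modulo \<open>b * c\<close> the elements \<open>v * c\<close> and \<open>u * b\<close>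
  are complementary idempotents, so a submodule above \<open>b * c\<close> is recovered from its two
  components.\<close>

lemma bij_betw_submodules_above_mult:
  assumes "comaximal b c"
  shows "bij_betw (\<lambda>(M, N). M \<inter> N) (submodules_above b \<times> submodules_above c)
    (submodules_above (b * c) :: ('a::comm_ring_1 ^ 'n) set set)"
proof -
  obtain u v where uv: "u * b + v * c = 1" using assms unfolding comaximal_def by blast
  \<comment> \<open>The component of \<open>M\<close> at \<open>b\<close> is its preimage under
    \<open>v * c\<close>, which is 1 modulo \<open>b\<close> and 0 modulo \<open>c\<close>; the
    component at \<open>c\<close> uses \<open>u * b\<close> in the same way.\<close>
  let ?part = "\<lambda>e (M :: ('a ^ 'n) set). {w. e *s w \<in> M}"
  have sub: "?part e M \<in> submodules" if "M \<in> submodules" for e M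
  proof -
    have "e *s (a *s w) = a *s (e *s w)" for a and w :: "'a ^ 'n" by (simp add: vec_eq_iff mult.left_commute)
    then show ?thesis using that submodule_scale[OF that]
      by (auto simp: submodules_iff vector_add_ldistrib simp del: vector_smult_assoc)
  qed
  have above: "?part e M \<in> submodules_above d" if "M \<in> submodules_above (b * c)" "b * c dvd e * d" for e d M
    using that sub[of M e] submodules_above_dvd[of "b * c" "e * d"]
    by (force simp: submodules_above_iff vector_smult_assoc)
  have left: "?part (v * c) (M \<inter> N) = M" if "M \<in> submodules_above b" "N \<in> submodules_above c" for M N
  proof (intro Set.set_eqI iffI; clarsimp)
    fix w
    show "(v * c) *s w \<in> M \<and> (v * c) *s w \<in> N" if "w \<in> M"
      using that \<open>M \<in> _\<close> \<open>N \<in> _\<close> by (auto simp: submodules_above_iff submodule_scale simp flip: vector_smult_assoc)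
    show "w \<in> M" if "(v * c) *s w \<in> M"
    proof -
      have "(u * b) *s w \<in> M" using \<open>M \<in> _\<close>
        by (auto simp: submodules_above_iff submodule_scale simp flip: vector_smult_assoc)
      then show ?thesis
        using that comaximal_split[OF uv, of w] \<open>M \<in> _\<close> submodule_add by (metis submodules_above_iff)
    qed
  qed
  have right: "?part (u * b) (M \<inter> N) = N" if "M \<in> submodules_above b" "N \<in> submodules_above c" for M N
  proof (intro Set.set_eqI iffI; clarsimp)
    fix w
    show "(u * b) *s w \<in> M \<and> (u * b) *s w \<in> N" if "w \<in> N"
      using that \<open>M \<in> _\<close> \<open>N \<in> _\<close> by (auto simp: submodules_above_iff submodule_scale simp flip: vector_smult_assoc)
    show "w \<in> N" if "(u * b) *s w \<in> N"
    proof -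
      have "(v * c) *s w \<in> N" using \<open>N \<in> _\<close>
        by (auto simp: submodules_above_iff submodule_scale simp flip: vector_smult_assoc)
      then show ?thesis
        using that comaximal_split[OF uv, of w] \<open>N \<in> _\<close> submodule_add by (metis submodules_above_iff)
    qed
  qed
  have inter: "?part (v * c) M \<inter> ?part (u * b) M = M" if "M \<in> submodules_above (b * c)" for M
  proof (intro Set.set_eqI iffI)
    fix w assume "w \<in> ?part (v * c) M \<inter> ?part (u * b) M"
    then show "w \<in> M"
      using that comaximal_split[OF uv, of w] submodule_add
      by (metis IntD1 IntD2 mem_Collect_eq submodules_above_iff)
  next
    fix w assume "w \<in> M"
    then show "w \<in> ?part (v * c) M \<inter> ?part (u * b) M"
      using that by (auto simp: submodules_above_iff submodule_scale)
  qed
  show ?thesis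
  proof (rule bij_betw_byWitness[where f' = "\<lambda>M. (?part (v * c) M, ?part (u * b) M)"])
    show "\<forall>x\<in>submodules_above b \<times> submodules_above c.
      (?part (v * c) (case x of (M, N) \<Rightarrow> M \<inter> N), ?part (u * b) (case x of (M, N) \<Rightarrow> M \<inter> N)) = x"
      using left right by auto
    show "\<forall>M\<in>submodules_above (b * c).
      (case (?part (v * c) M, ?part (u * b) M) of (M, N) \<Rightarrow> M \<inter> N) = M"
      using inter by auto
    show "(\<lambda>(M, N). M \<inter> N) ` (submodules_above b \<times> submodules_above c) \<subseteq> submodules_above (b * c)"
      using submodules_above_inter by auto
    show "(\<lambda>M. (?part (v * c) M, ?part (u * b) M)) ` submodules_above (b * c) \<subseteq>
        submodules_above b \<times> submodules_above c"
    proof -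
      have "v * c * b = b * c * v" "u * b * c = b * c * u" by (simp_all add: mult_ac)
      then have "b * c dvd v * c * b" "b * c dvd u * b * c" by (simp_all only: dvd_triv_left)
      then show ?thesis using above by blast
    qed
  qed
qed

text \<open>The map sending \<open>w\<close> to its cosets modulo \<open>M\<close> and
  \<open>N\<close> identifies vectors exactly when they agree modulo \<open>M \<inter> N\<close>,
  and it is onto by simultaneous congruences. Solutions stay in \<open>K \<inter> L\<close> because
  they differ from elements of \<open>K\<close> and \<open>L\<close> by elements of \<open>M\<close>
  and \<open>N\<close>.\<close>

lemma card_cosets_inter:
  assumes "comaximal b c" and M: "M \<in> submodules_above b" and N: "N \<in> submodules_above c"
    and K: "K \<in> submodules" "M \<subseteq> K" and L: "L \<in> submodules" "N \<subseteq> L"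
  shows "card (cosets (K \<inter> L) (M \<inter> N)) = card (cosets K M) * card (cosets L N)"
proof -
  obtain u v where uv: "u * b + v * c = 1" using assms unfolding comaximal_def by blast
  have sub: "M \<in> submodules" "N \<in> submodules" "M \<inter> N \<in> submodules"
    using M N submodules_above_inter[OF M N] by (auto simp: submodules_above_iff)
  have ex: "\<exists>w. w - x \<in> M \<and> w - y \<in> N" for x y
  proof (intro exI conjI)
    \<comment> \<open>Since \<open>v * c\<close> is 1 modulo \<open>b\<close> and
      \<open>u * b\<close> is 1 modulo \<open>c\<close>, this vector is \<open>x\<close> modulo
      \<open>b\<close> and \<open>y\<close> modulo \<open>c\<close>.\<close>
    let ?w = "(v * c) *s x + (u * b) *s y"
    have "?w - x = ?w - ((u * b) *s x + (v * c) *s x)" by (simp only: comaximal_split[OF uv])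
    also have "\<dots> = u *s (b *s (y - x))"
      by (simp add: vec_eq_iff algebra_simps)
    finally have "?w - x = u *s (b *s (y - x))" .
    moreover have "u *s (b *s (y - x)) \<in> M"
      using M submodule_scale by (auto simp only: submodules_above_iff)
    ultimately show "?w - x \<in> M" by (simp only:)
    have "?w - y = ?w - ((u * b) *s y + (v * c) *s y)" by (simp only: comaximal_split[OF uv])
    also have "\<dots> = v *s (c *s (x - y))"
      by (simp add: vec_eq_iff algebra_simps)
    finally have "?w - y = v *s (c *s (x - y))" .
    moreover have "v *s (c *s (x - y)) \<in> N"
      using N submodule_scale by (auto simp only: submodules_above_iff)
    ultimately show "?w - y \<in> N" by (simp only:)
  qed
  define pair where "pair w = (w +o M, w +o N)" for w
  have img: "pair ` (K \<inter> L) = cosets K M \<times> cosets L N"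
  proof (intro equalityI subsetI)
    fix z assume "z \<in> cosets K M \<times> cosets L N"
    then obtain x y where xy: "x \<in> K" "y \<in> L" "z = (x +o M, y +o N)" by (auto simp: cosets_def)
    obtain w where w: "w - x \<in> M" "w - y \<in> N" using ex by blast
    have "w \<in> K" using submodule_add[OF K(1), of x "w - x"] w K xy by auto
    moreover have "w \<in> L" using submodule_add[OF L(1), of y "w - y"] w L xy by auto
    moreover have "z = pair w" using w sub by (simp add: xy pair_def coset_eq_iff submodule_diff_commute)
    ultimately show "z \<in> pair ` (K \<inter> L)" by blast
  qed (auto simp: pair_def cosets_def)
  have "card (cosets (K \<inter> L) (M \<inter> N)) = card (pair ` (K \<inter> L))"
    unfolding cosets_def
    by (rule card_image_same_kernel) (auto simp: pair_def coset_eq_iff sub)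
  then show ?thesis by (simp add: img card_cartesian_product)
qed

section \<open>The weighted sum over submodules and its Euler product\<close>

definition weighted_term :: "('a::comm_ring_1 laurent_poly ^ 'n) set \<Rightarrow> nat dirichlet_series"
  where "weighted_term M = of_nat (tau M) * ds_term (mod_index M)"

lemma tau_kernel_submodule:
  fixes M :: "('a::comm_ring_1 ^ 'n) set"
  assumes "M \<in> submodules"
  shows "{v. a *s v \<in> M} \<in> submodules" "M \<subseteq> {v. a *s v \<in> M}"
proof -
  have "a *s (c *s v) = c *s (a *s v)" for c and v :: "'a ^ 'n"
    by (simp add: vec_eq_iff mult.left_commute)
  then show "{v. a *s v \<in> M} \<in> submodules"
    using assms submodule_scale[OF assms]
    by (auto simp: submodules_iff vector_add_ldistrib simp del: vector_smult_assoc)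
  show "M \<subseteq> {v. a *s v \<in> M}" using assms submodule_scale by blast
qed

lemma weighted_term_inter:
  assumes bc: "comaximal b c" and M: "M \<in> submodules_above b" and N: "N \<in> submodules_above c"
  shows "weighted_term (M \<inter> N) = weighted_term M * weighted_term N"
proof -
  have sub: "M \<in> submodules" "N \<in> submodules" "M \<inter> N \<in> submodules"
    using M N submodules_above_inter[OF M N] by (auto simp: submodules_above_iff)
  have U: "UNIV \<in> (submodules :: ('a laurent_poly ^ 'n) set set)" by (simp add: submodules_iff)
  have "mod_index (M \<inter> N) = mod_index M * mod_index N"
    using card_cosets_inter[OF bc M N U _ U] by (simp add: mod_index_eq)
  moreover have "tau (M \<inter> N) = tau M * tau N"
    using card_cosets_inter[OF bc M N tau_kernel_submodule[OF sub(1)] tau_kernel_submodule[OF sub(2)],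
        of "1 - laurent_X" "1 - laurent_X"]
    by (simp add: tau_eq sub Collect_conj_eq flip: Int_def)
  ultimately show ?thesis
    by (simp add: weighted_term_def mult_ac flip: ds_term_mult)
qed

lemma weighted_term_UNIV: "weighted_term (UNIV :: ('a::comm_ring_1 laurent_poly ^ 'n) set) = 1"
proof -
  have U: "UNIV \<in> (submodules :: ('a laurent_poly ^ 'n) set set)" by (simp add: submodules_iff)
  have "cosets UNIV UNIV = {UNIV :: ('a laurent_poly ^ 'n) set}"
    using coset_eq_self_iff[OF U] by (auto simp: cosets_def)
  moreover have "ds_term 1 = (1 :: nat dirichlet_series)"
    by transfer auto
  ultimately show ?thesis by (simp add: weighted_term_def tau_eq[OF U] mod_index_eq)
qed

lemma sum_weighted_term_mult:
  assumes bc: "comaximal b c"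
  shows "sum weighted_term (submodules_above (b * c) :: ('a::comm_ring_1 laurent_poly ^ 'n) set set) =
    sum weighted_term (submodules_above b :: ('a laurent_poly ^ 'n) set set) *
    sum weighted_term (submodules_above c :: ('a laurent_poly ^ 'n) set set)"
proof -
  have "sum weighted_term (submodules_above (b * c) :: ('a laurent_poly ^ 'n) set set) =
      (\<Sum>z\<in>submodules_above b \<times> submodules_above c.
        weighted_term (case z of (M, N) \<Rightarrow> (M \<inter> N :: ('a laurent_poly ^ 'n) set)))"
    using sum.reindex_bij_betw[OF bij_betw_submodules_above_mult[OF bc],
        of weighted_term] by (rule sym)
  also have "\<dots> = (\<Sum>(M, N)\<in>submodules_above b \<times> submodules_above c.
      weighted_term (M :: ('a laurent_poly ^ 'n) set) * weighted_term (N :: ('a laurent_poly ^ 'n) set))"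
    by (rule sum.cong) (auto simp: weighted_term_inter[OF bc])
  finally show ?thesis by (simp add: sum_product sum.cartesian_product)
qed

lemma sum_weighted_term_prod:
  fixes f :: "'i \<Rightarrow> 'a::comm_ring_1 laurent_poly"
  assumes "finite I" "\<And>i j. i \<in> I \<Longrightarrow> j \<in> I \<Longrightarrow> i \<noteq> j \<Longrightarrow> comaximal (f i) (f j)"
  shows "sum weighted_term (submodules_above (prod f I) :: ('a laurent_poly ^ 'n) set set) =
    (\<Prod>i\<in>I. sum weighted_term (submodules_above (f i) :: ('a laurent_poly ^ 'n) set set))"
  using assms
proof (induction I rule: finite_induct)
  case empty
  then show ?case by (simp add: submodules_above_one weighted_term_UNIV)
next
  case (insert i I)
  then have "comaximal (f i) (prod f I)" by (intro comaximal_prod) auto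
  with insert show ?case by (simp add: sum_weighted_term_mult)
qed

text \<open>The quotient is annihilated by \<open>c\<close>, so a Bezout identity inverts
  \<open>1 - x\<close> on it and the kernel is trivial.\<close>

lemma tau_eq_1:
  assumes M: "M \<in> submodules_above c" and c: "comaximal c (1 - laurent_X)"
  shows "tau M = 1"
proof -
  have sub: "M \<in> submodules" using M by (simp add: submodules_above_iff)
  obtain u v where uv: "u * c + v * (1 - laurent_X) = 1" using c unfolding comaximal_def by blast
  have "w \<in> M" if "(1 - laurent_X) *s w \<in> M" for w
  proof -
    have "u *s (c *s w) + v *s ((1 - laurent_X) *s w) \<in> M"
      using sub that M submodule_scale submodule_add by (metis submodules_above_iff)
    moreover have "u *s (c *s w) + v *s ((1 - laurent_X) *s w) = w"
      using comaximal_split[OF uv, of w] by (simp only: vector_smult_assoc)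
    ultimately show ?thesis by (simp only:)
  qed
  then have "{v. (1 - laurent_X) *s v \<in> M} = M"
    using tau_kernel_submodule(2)[OF sub, of "1 - laurent_X"] by blast
  moreover have "cosets M M = {M}"
  proof -
    have "cosets M M = (\<lambda>v. M) ` M"
      unfolding cosets_def by (rule image_cong) (simp_all add: coset_eq_self_iff[OF sub])
    then show ?thesis using submodule_0[OF sub] by auto
  qed
  ultimately show ?thesis by (simp add: tau_eq[OF sub])
qed

text \<open>Membership in \<open>Mod_at r\<close> provides some power \<open>r ^ j\<close> of
  unknown exponent. Multiplying a Bezout identity for \<open>r ^ j\<close> and \<open>c\<close> by
  \<open>r ^ k\<close> writes \<open>r ^ k\<close> through \<open>r ^ j\<close> and
  \<open>r ^ k * c\<close>, which brings the exponent to the one occurring in the modulus.\<close>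

lemma Mod_at_above_eq:
  fixes r c :: "'a::comm_ring_1"
  assumes "comaximal r c"
  shows "{M. M \<in> Mod_at r \<and> range ((*s) (r ^ k * c)) \<subseteq> M} = (submodules_above (r ^ k) :: ('a ^ 'n) set set)"
proof (intro equalityI subsetI)
  fix M :: "('a ^ 'n) set" assume M: "M \<in> submodules_above (r ^ k)"
  then have "M \<in> submodules_above (r ^ k * c)" using submodules_above_dvd dvd_triv_left by blast
  with M show "M \<in> {M. M \<in> Mod_at r \<and> range ((*s) (r ^ k * c)) \<subseteq> M}"
    by (auto simp: Mod_at_def submodules_above_def)
next
  fix M :: "('a ^ 'n) set" assume "M \<in> {M. M \<in> Mod_at r \<and> range ((*s) (r ^ k * c)) \<subseteq> M}"
  then obtain j where M: "M \<in> submodules" and j: "\<And>v. (r ^ j) *s v \<in> M"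
    and kc: "\<And>v. (r ^ k * c) *s v \<in> M"
    unfolding Mod_at_def by blast
  have "comaximal (r ^ j) (c ^ 1)" using assms by (rule comaximal_power)
  then obtain u v where uv: "u * r ^ j + v * c = 1" unfolding comaximal_def by auto
  have "(r ^ k) *s w \<in> M" for w
  proof -
    have "(u * r ^ k) *s ((r ^ j) *s w) + v *s ((r ^ k * c) *s w) \<in> M"
      using M j kc submodule_scale submodule_add by metis
    moreover have "(u * r ^ k) *s ((r ^ j) *s w) + v *s ((r ^ k * c) *s w) =
        (r ^ k * (u * r ^ j + v * c)) *s w"
      by (simp add: vec_eq_iff algebra_simps)
    ultimately show ?thesis by (simp add: uv)
  qed
  with M show "M \<in> submodules_above (r ^ k)" by (simp add: submodules_above_iff)
qed

lemma normalized_prime_dvd_prod_mset: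
  fixes A :: "'a::field laurent_poly multiset"
  assumes r: "r \<in> normalized_primes" and A: "set_mset A \<subseteq> normalized_primes" and "r dvd prod_mset A"
  shows "r \<in># A"
  using A \<open>r dvd prod_mset A\<close>
proof (induction A)
  case empty
  then show ?case using r by (simp add: normalized_primes_def prime_elem_def)
next
  case (add q A)
  from r have "prime_elem r" by (simp add: normalized_primes_def)
  then have "r dvd q \<or> r dvd prod_mset A" using add.prems(2) by (simp add: prime_elem_def)
  then show ?case using add normalized_primes_dvd_imp_eq[OF r, of q] by auto
qed

lemma sum_weighted_term_factorization:
  fixes a :: "'a::field laurent_poly"
  assumes a: "a \<noteq> 0" and dvd: "1 - laurent_X dvd a"
  shows "sum weighted_term (submodules_above a :: ('a laurent_poly ^ 'n) set set) =
    (\<Prod>r | r \<in> normalized_primes \<and> r dvd a \<and> r \<noteq> 1 - laurent_X.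
       \<Sum>M | M \<in> (Mod_at r :: ('a laurent_poly ^ 'n) set set) \<and> range ((*s) a) \<subseteq> M. ds_term (mod_index M)) *
    (\<Sum>M | M \<in> (Mod_at (1 - laurent_X) :: ('a laurent_poly ^ 'n) set set) \<and> range ((*s) a) \<subseteq> M.
       of_nat (tau M) * ds_term (mod_index M))"
proof -
  let ?e = "1 - laurent_X :: 'a laurent_poly"
  obtain u A where u: "u dvd 1" and A: "set_mset A \<subseteq> normalized_primes" and ua: "a = u * prod_mset A"
    using laurent_factorization[OF a] by blast
  \<comment> \<open>The unit is dropped: \<open>a\<close> and \<open>b\<close> divide each other, so
    the same submodules lie above both.\<close>
  define b where "b = prod_mset A"
  have ab: "a dvd b" "b dvd a"
    using unit_mult_dvd[OF u dvd_refl[of b]] by (simp_all add: ua b_def)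
  have above: "submodules_above a = (submodules_above b :: ('a laurent_poly ^ 'n) set set)"
    using submodules_above_dvd ab by blast
  then have range: "M \<in> Mod_at r \<and> range ((*s) a) \<subseteq> M \<longleftrightarrow> M \<in> Mod_at r \<and> range ((*s) b) \<subseteq> M"
    for r and M :: "('a laurent_poly ^ 'n) set"
    unfolding Mod_at_def submodules_above_def by blast
  have P: "{r \<in> normalized_primes. r dvd a} = set_mset A"
  proof -
    have "r dvd a \<longleftrightarrow> r dvd b" for r using ab dvd_trans by blast
    moreover have "r dvd b" if "r \<in># A" for r using that by (simp add: b_def dvd_prod_mset)
    ultimately show ?thesis using A normalized_prime_dvd_prod_mset[OF _ A] by (auto simp: b_def)
  qed
  \<comment> \<open>The divisibility hypothesis makes \<open>1 - x\<close> one of the primes in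
    \<open>A\<close>, so that its factor can be split off from the product.\<close>
  have e: "?e \<in># A" using P dvd one_minus_laurent_X_normalized by blast
  define g where "g r = r ^ count A r" for r
  have comax: "comaximal r q" if "r \<in># A" "q \<in># A" "r \<noteq> q" for r q
    using that A normalized_primes_comaximal by blast
  have comax_g: "comaximal (g r) (g q)" if "r \<in># A" "q \<in># A" "r \<noteq> q" for r q
    using comax[OF that] by (simp add: g_def comaximal_power)
  have bg: "b = prod g (set_mset A)" by (simp add: b_def g_def prod_mset_multiplicity)
  have Mod: "{M. M \<in> Mod_at r \<and> range ((*s) a) \<subseteq> M} = (submodules_above (g r) :: ('a laurent_poly ^ 'n) set set)"
    if r: "r \<in># A" for r
  proof -
    have "b = r ^ count A r * prod g (set_mset A - {r})"
      unfolding bg using r by (subst prod.remove[of _ r]) (auto simp: g_def)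
    moreover have "comaximal r (prod g (set_mset A - {r}))"
    proof (rule comaximal_prod)
      fix q assume "q \<in> set_mset A - {r}"
      then have "comaximal (r ^ 1) (g q)" unfolding g_def using r by (intro comaximal_power comax) auto
      then show "comaximal r (g q)" by simp
    qed
    ultimately show ?thesis
      using Mod_at_above_eq[of r "prod g (set_mset A - {r})" "count A r"] by (simp add: range g_def)
  qed
  \<comment> \<open>At these primes the weight reduces to the plain index term, because a power of
    \<open>r\<close> is comaximal to \<open>1 - x\<close>.\<close>
  have inner: "(\<Sum>M | M \<in> (Mod_at r :: ('a laurent_poly ^ 'n) set set) \<and> range ((*s) a) \<subseteq> M. ds_term (mod_index M)) =
      sum weighted_term (submodules_above (g r) :: ('a laurent_poly ^ 'n) set set)"
    if "r \<in> set_mset A - {?e}" for r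
  proof (rule sum.cong)
    have "comaximal (r ^ count A r) (?e ^ 1)"
      using that e by (intro comaximal_power comax) auto
    then show "ds_term (mod_index M) = weighted_term M"
      if "M \<in> submodules_above (g r)" for M :: "('a laurent_poly ^ 'n) set"
      using tau_eq_1[OF that] by (simp add: weighted_term_def g_def)
  qed (use that Mod in auto)
  have PA: "{r. r \<in> normalized_primes \<and> r dvd a \<and> r \<noteq> ?e} = set_mset A - {?e}"
    using P by auto
  have "sum weighted_term (submodules_above a :: ('a laurent_poly ^ 'n) set set) =
      (\<Prod>r\<in>set_mset A. sum weighted_term (submodules_above (g r) :: ('a laurent_poly ^ 'n) set set))"
    unfolding above bg using comax_g by (intro sum_weighted_term_prod) auto
  also have "\<dots> = (\<Prod>r\<in>set_mset A - {?e}. sum weighted_term (submodules_above (g r) :: ('a laurent_poly ^ 'n) set set))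
      * sum weighted_term (submodules_above (g ?e) :: ('a laurent_poly ^ 'n) set set)"
    using e by (subst prod.remove[of _ ?e]) (auto simp: mult.commute)
  also have "\<dots> = (\<Prod>r\<in>set_mset A - {?e}. \<Sum>M | M \<in> (Mod_at r :: ('a laurent_poly ^ 'n) set set) \<and> range ((*s) a) \<subseteq> M.
       ds_term (mod_index M)) * sum weighted_term (submodules_above (g ?e) :: ('a laurent_poly ^ 'n) set set)"
    by (intro arg_cong2[of _ _ _ _ "(*)"] prod.cong refl inner[symmetric])
  finally show ?thesis
    unfolding PA Mod[OF e] weighted_term_def .
qed

section \<open>Finiteness modulo \<open>1 - x\<^sup>s\<close>\<close>

text \<open>For \<open>s > 0\<close> these represent all classes modulo
  \<open>1 - x^s\<close>.\<close>

definition reduced_vectors :: "int \<Rightarrow> ('a::zero laurent_poly ^ 'n) set"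
  where "reduced_vectors s = {v. \<forall>j. Poly_Mapping.keys (v $ j) \<subseteq> {0..<s}}"

lemma finite_reduced_vectors: "finite (reduced_vectors s :: ('a::{finite, zero} laurent_poly ^ 'n) set)"
proof -
  let ?D = "{d :: 'a laurent_poly. Poly_Mapping.keys d \<subseteq> {0..<s}}"
  have "finite {f :: int \<Rightarrow> 'a. \<forall>i. (i \<in> {0..<s} \<longrightarrow> f i \<in> UNIV) \<and> (i \<notin> {0..<s} \<longrightarrow> f i = 0)}"
    by (rule finite_set_of_finite_funs) auto
  then have "finite (Poly_Mapping.lookup ` ?D)"
    by (rule finite_subset[rotated]) (auto simp: in_keys_iff subset_eq)
  then have "finite ?D" by (rule finite_imageD) (auto simp: inj_on_def intro: poly_mapping_eqI)
  then have "finite (vec_lambda ` (Pi\<^sub>E UNIV (\<lambda>_ :: 'n. ?D)))" by (intro finite_imageI finite_PiE) auto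
  moreover have "reduced_vectors s \<subseteq> vec_lambda ` (Pi\<^sub>E UNIV (\<lambda>_ :: 'n. ?D))"
  proof
    fix v :: "'a laurent_poly ^ 'n" assume "v \<in> reduced_vectors s"
    then have "vec_nth v \<in> Pi\<^sub>E UNIV (\<lambda>_. ?D)" by (auto simp: reduced_vectors_def)
    then show "v \<in> vec_lambda ` (Pi\<^sub>E UNIV (\<lambda>_. ?D))" by (intro image_eqI[of _ _ "vec_nth v"]) simp_all
  qed
  ultimately show ?thesis by (rule finite_subset[rotated])
qed

lemma vector_reduce_mod:
  fixes v :: "'a::comm_ring_1 laurent_poly ^ 'n"
  assumes "s > 0"
  shows "\<exists>d\<in>reduced_vectors s. \<exists>w. v - d = (1 - Poly_Mapping.single s 1) *s w"
proof -
  have "\<forall>j. \<exists>d w. Poly_Mapping.keys d \<subseteq> {0..<s} \<and> v $ j - d = (1 - Poly_Mapping.single s 1) * w"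
    using laurent_reduce_mod[OF assms] unfolding dvd_def by metis
  then obtain d w where dw: "\<And>j. Poly_Mapping.keys (d j) \<subseteq> {0..<s}"
    "\<And>j. v $ j - d j = (1 - Poly_Mapping.single s 1) * w j" by metis
  have "v - vec_lambda d = (1 - Poly_Mapping.single s 1) *s vec_lambda w"
    using dw(2) by (simp only: vec_eq_iff vector_minus_component vector_smult_component vec_lambda_beta) blast
  moreover have "vec_lambda d \<in> reduced_vectors s" using dw(1) by (simp add: reduced_vectors_def)
  ultimately show ?thesis by blast
qed

text \<open>Stable under adding multiples of \<open>1 - x^s\<close>, such a submodule is determined
  by the reduced vectors in it, hence by a subset of a finite set.\<close>

lemma finite_submodules_above:
  assumes "s > 0"
  shows "finite (submodules_above (1 - Poly_Mapping.single s 1) :: ('a::{finite, comm_ring_1} laurent_poly ^ 'n) set set)"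
proof (rule finite_imageD)
  let ?T = "submodules_above (1 - Poly_Mapping.single s 1) :: ('a laurent_poly ^ 'n) set set"
  have mem: "v \<in> M \<longleftrightarrow>
      (\<exists>d\<in>M \<inter> reduced_vectors s. \<exists>w. v - d = (1 - Poly_Mapping.single s 1) *s w)"
    if M: "M \<in> ?T" for M v
  proof
    assume v: "v \<in> M"
    obtain d w where d: "d \<in> reduced_vectors s" and w: "v - d = (1 - Poly_Mapping.single s 1) *s w"
      using vector_reduce_mod[OF assms] by blast
    have "v - (v - d) \<in> M"
      using M v unfolding w by (intro submodule_diff) (simp_all only: submodules_above_iff)
    then have "d \<in> M" by simp
    then show "\<exists>d\<in>M \<inter> reduced_vectors s. \<exists>w. v - d = (1 - Poly_Mapping.single s 1) *s w"
      using d w by blast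
  next
    assume "\<exists>d\<in>M \<inter> reduced_vectors s. \<exists>w. v - d = (1 - Poly_Mapping.single s 1) *s w"
    then obtain d w where d: "d \<in> M" and w: "v - d = (1 - Poly_Mapping.single s 1) *s w" by blast
    have "(v - d) + d \<in> M"
      using M d unfolding w by (intro submodule_add) (simp_all only: submodules_above_iff)
    then show "v \<in> M" by simp
  qed
  show "inj_on (\<lambda>M. M \<inter> reduced_vectors s) ?T"
  proof (rule inj_onI)
    fix M N assume *: "M \<in> ?T" "N \<in> ?T" "M \<inter> reduced_vectors s = N \<inter> reduced_vectors s"
    have "v \<in> M \<longleftrightarrow> v \<in> N" for v
      unfolding mem[OF *(1)] mem[OF *(2)] *(3) ..
    then show "M = N" by blast
  qed
  show "finite ((\<lambda>M. M \<inter> reduced_vectors s) ` ?T)"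
    by (rule finite_subset[of _ "Pow (reduced_vectors s)"]) (auto simp: finite_reduced_vectors)
qed

lemma finite_quot:
  fixes M :: "('a::{finite, comm_ring_1} laurent_poly ^ 'n) set"
  assumes "s > 0" and M: "M \<in> submodules_above (1 - Poly_Mapping.single s 1)"
  shows "finite (quot M)"
proof -
  have sub: "M \<in> submodules" using M by (simp only: submodules_above_iff)
  have "quot M \<subseteq> (\<lambda>d. d +o M) ` reduced_vectors s"
  proof
    fix C assume "C \<in> quot M"
    then obtain v where C: "C = v +o M" by (auto simp: quot_def)
    obtain d w where d: "d \<in> reduced_vectors s" and w: "v - d = (1 - Poly_Mapping.single s 1) *s w"
      using vector_reduce_mod[OF assms(1)] by blast
    have "v - d \<in> M" unfolding w using M by (simp only: submodules_above_iff)
    then have "C = d +o M" by (simp add: C coset_eq_iff[OF sub])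
    with d show "C \<in> (\<lambda>d. d +o M) ` reduced_vectors s" by blast
  qed
  then show ?thesis by (rule finite_subset) (simp add: finite_reduced_vectors)
qed

section \<open>Normal subgroups of the wreath product\<close>

definition to_laurent :: "(int \<Rightarrow>\<^sub>0 'a::zero ^ 'n) \<Rightarrow> 'a laurent_poly ^ 'n"
  where "to_laurent f = (\<chi> j. Poly_Mapping.map (\<lambda>v. v $ j) f)"

lemma lookup_to_laurent:
  "Poly_Mapping.lookup (to_laurent f $ j) k = Poly_Mapping.lookup f k $ j"
  by (simp add: to_laurent_def map.rep_eq when_def)

lemma to_laurent_eqI:
  "(\<And>j k. Poly_Mapping.lookup f k $ j = Poly_Mapping.lookup (v $ j) k) \<Longrightarrow> to_laurent f = v"
  by (simp add: vec_eq_iff lookup_to_laurent poly_mapping_eqI)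

lemma bij_to_laurent: "bij (to_laurent :: _ \<Rightarrow> 'a::zero laurent_poly ^ 'n)"
proof (rule bijI)
  show "inj (to_laurent :: _ \<Rightarrow> 'a laurent_poly ^ 'n)"
  proof (rule injI)
    fix f g :: "int \<Rightarrow>\<^sub>0 'a ^ 'n" assume "to_laurent f = to_laurent g"
    then have "Poly_Mapping.lookup f k $ j = Poly_Mapping.lookup g k $ j" for k j
      by (metis lookup_to_laurent)
    then show "f = g" by (intro poly_mapping_eqI) (simp add: vec_eq_iff)
  qed
  have "\<exists>f. to_laurent f = v" for v :: "'a laurent_poly ^ 'n"
  proof -
    let ?f = "\<lambda>k. \<chi> j. Poly_Mapping.lookup (v $ j) k"
    have "{k. ?f k \<noteq> 0} \<subseteq> (\<Union>j. Poly_Mapping.keys (v $ j))"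
      by (auto simp: vec_eq_iff in_keys_iff)
    then have "finite {k. ?f k \<noteq> 0}" by (rule finite_subset) auto
    then have "Poly_Mapping.lookup (Abs_poly_mapping ?f) = ?f" by (rule lookup_Abs_poly_mapping)
    then have "to_laurent (Abs_poly_mapping ?f) = v" by (intro to_laurent_eqI) simp
    then show ?thesis by blast
  qed
  then show "surj (to_laurent :: _ \<Rightarrow> 'a laurent_poly ^ 'n)" by (metis surjI)
qed

lemma to_laurent_add: "to_laurent (f + g) = to_laurent f + to_laurent (g :: int \<Rightarrow>\<^sub>0 'a::monoid_add ^ 'n)"
  by (rule to_laurent_eqI) (simp add: lookup_add lookup_to_laurent)

lemma to_laurent_0: "to_laurent 0 = 0"
  by (rule to_laurent_eqI) simp

lemma to_laurent_uminus: "to_laurent (- f) = - to_laurent (f :: int \<Rightarrow>\<^sub>0 'a::ab_group_add ^ 'n)"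
  by (rule to_laurent_eqI) (simp add: lookup_to_laurent)

lemma to_laurent_diff: "to_laurent (f - g) = to_laurent f - to_laurent (g :: int \<Rightarrow>\<^sub>0 'a::ab_group_add ^ 'n)"
  by (rule to_laurent_eqI) (simp add: lookup_to_laurent lookup_minus)

text \<open>This turns the action of the integers in the wreath product into the module structure:
  invariance under conjugation by the generator becomes closure under multiplication by powers of
  \<open>x\<close>.\<close>

lemma to_laurent_shift:
  fixes f :: "int \<Rightarrow>\<^sub>0 'a::comm_ring_1 ^ 'n"
  shows "to_laurent (shift k f) = Poly_Mapping.single k 1 *s to_laurent f"
  by (rule to_laurent_eqI) (simp add: lookup_shift lookup_single_mult_int lookup_to_laurent)

lemmas to_laurent_simps = to_laurent_add to_laurent_0 to_laurent_uminus to_laurent_diff to_laurent_shift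

lemma ex_to_laurent: "\<exists>f. to_laurent f = (v :: 'a::zero laurent_poly ^ 'n)"
  using bij_to_laurent bij_pointE by metis

lemma carrier_wreath: "carrier wreath_int = UNIV"
  and mult_wreath: "(f, k) \<otimes>\<^bsub>wreath_int\<^esub> (g, l) = (f + shift k g, k + l)"
  and one_wreath: "\<one>\<^bsub>wreath_int\<^esub> = (0, 0)"
  by (simp_all add: wreath_int_def)

lemma shift_uminus: "shift k (- h) = - shift k (h :: int \<Rightarrow>\<^sub>0 'b::ab_group_add)"
  and shift_shift: "shift k (shift l e) = shift (k + l) (e :: int \<Rightarrow>\<^sub>0 'c::zero)"
  and shift_by_0: "shift 0 e = e"
  and shift_0: "shift k 0 = (0 :: int \<Rightarrow>\<^sub>0 'c)"
  by (rule poly_mapping_eqI; simp add: lookup_shift lookup_add algebra_simps)+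

lemma inv_wreath: "inv\<^bsub>wreath_int\<^esub> (f, k) = (- shift (- k) f, - k)"
proof -
  interpret group "wreath_int :: ((int \<Rightarrow>\<^sub>0 'a) \<times> int) monoid" by (rule group_wreath_int)
  show ?thesis
    by (rule inv_equality) (simp_all add: mult_wreath one_wreath carrier_wreath)
qed

lemma mult_inv_wreath:
  "(f, k) \<otimes>\<^bsub>wreath_int\<^esub> inv\<^bsub>wreath_int\<^esub> (g, l) = (f - shift (k - l) g, k - l)"
  by (simp add: inv_wreath mult_wreath shift_uminus shift_shift)

text \<open>For \<open>l = 0\<close> the base component is \<open>f + (1 - x^k) g\<close>, and for
  \<open>g = 0\<close> it is \<open>x^l f\<close>. These two cases yield the two conditions on a
  normal subgroup.\<close>

lemma conj_wreath:
  "(g, l) \<otimes>\<^bsub>wreath_int\<^esub> (f, k) \<otimes>\<^bsub>wreath_int\<^esub> inv\<^bsub>wreath_int\<^esub> (g, l) = (g + shift l f - shift k g, k)"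
  by (simp add: mult_wreath mult_inv_wreath)

lemma (in group) rcoset_eq_iff:
  assumes H: "subgroup H G" and x: "x \<in> carrier G" and y: "y \<in> carrier G"
  shows "H #> x = H #> y \<longleftrightarrow> x \<otimes> inv y \<in> H"
proof
  assume "H #> x = H #> y"
  then have "x \<in> H #> y" using rcos_self[OF x H] by simp
  then obtain h where h: "h \<in> H" "x = h \<otimes> y" by (auto simp: r_coset_def)
  have "h \<in> carrier G" using subgroup.mem_carrier[OF H h(1)] .
  then have "x \<otimes> inv y = h" using h(2) y by (simp add: m_assoc)
  then show "x \<otimes> inv y \<in> H" using h(1) by simp
next
  assume *: "x \<otimes> inv y \<in> H"
  have "x = (x \<otimes> inv y) \<otimes> y" using x y by (simp add: m_assoc)
  then have "x \<in> H #> y" using * by (auto simp: r_coset_def)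
  then show "H #> x = H #> y" using repr_independence[OF _ y H] by simp
qed

lemma submodule_mem_cong:
  assumes M: "M \<in> submodules" and "v - w \<in> M"
  shows "w \<in> M \<longleftrightarrow> v \<in> M"
proof
  show "v \<in> M" if "w \<in> M" using submodule_add[OF M assms(2) that] by simp
  show "w \<in> M" if "v \<in> M" using submodule_diff[OF M that assms(2)] by simp
qed

text \<open>As \<open>x\<close> fixes \<open>v\<close> modulo \<open>M\<close>, the power \<open>(v, s)\<^sup>j\<close> is \<open>(j v, j s)\<close> modulo \<open>M\<close>.\<close>

definition wreath_subgroup ::
    "nat \<Rightarrow> ('a::comm_ring_1 laurent_poly ^ 'n) set \<Rightarrow> 'a laurent_poly ^ 'n \<Rightarrow> ((int \<Rightarrow>\<^sub>0 'a ^ 'n) \<times> int) set"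
  where "wreath_subgroup s M v =
    {(f, k). int s dvd k \<and> to_laurent f - of_int (k div int s) *s v \<in> M}"

lemma wreath_subgroup_iff:
  assumes "s > 0"
  shows "(f, j * int s) \<in> wreath_subgroup s M v \<longleftrightarrow> to_laurent f - of_int j *s v \<in> M"
  using assms by (simp add: wreath_subgroup_def)

lemma wreath_subgroup_cases:
  assumes "x \<in> wreath_subgroup s M v" "s > 0"
  obtains f j where "x = (f, j * int s)" "to_laurent f - of_int j *s v \<in> M"
  using assms unfolding wreath_subgroup_def by (auto elim!: dvdE simp: mult.commute)

section \<open>Normality and index of the subgroup attached to \<open>s\<close>, \<open>M\<close>
  and \<open>v\<close>\<close>

context
  fixes s :: nat and M :: "('a::comm_ring_1 laurent_poly ^ 'n) set" and v
  assumes s: "s > 0" and M: "M \<in> submodules_above (1 - Poly_Mapping.single (int s) 1)"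
    and v: "(1 - laurent_X) *s v \<in> M"
begin

lemma submodule_M: "M \<in> submodules"
  using M by (simp only: submodules_above_iff)

text \<open>Multiplication by \<open>x^s\<close> is trivial modulo \<open>M\<close>, hence so is
  that by all its powers, negative ones included.\<close>

lemma period_shift: "Poly_Mapping.single (j * int s) 1 *s w - w \<in> M"
proof -
  have "M \<in> submodules_above (1 - Poly_Mapping.single (j * int s) 1)"
    using M submodules_above_dvd[OF one_minus_single_dvd] by blast
  then have "- ((1 - Poly_Mapping.single (j * int s) 1) *s w) \<in> M"
    using submodule_uminus[OF submodule_M] by (simp only: submodules_above_iff)
  moreover have "- ((1 - Poly_Mapping.single (j * int s) 1) *s w) = Poly_Mapping.single (j * int s) 1 *s w - w"
    by (simp add: vec_eq_iff algebra_simps)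
  ultimately show ?thesis by (simp only:)
qed

lemma shift_representative: "Poly_Mapping.single k 1 *s v - v \<in> M"
proof -
  have "1 - laurent_X dvd 1 - Poly_Mapping.single k (1 :: 'a)"
    using one_minus_single_dvd[of 1 k] by (simp add: laurent_X_def)
  then obtain c where c: "1 - Poly_Mapping.single k (1 :: 'a) = (1 - laurent_X) * c" ..
  have "(- c) *s ((1 - laurent_X) *s v) \<in> M"
    using submodule_scale[OF submodule_M v] .
  moreover have "(- c) *s ((1 - laurent_X) *s v) = - ((1 - Poly_Mapping.single k 1) *s v)"
    unfolding c by (simp add: vec_eq_iff algebra_simps)
  moreover have "- ((1 - Poly_Mapping.single k 1) *s v) = Poly_Mapping.single k 1 *s v - v"
    by (simp add: vec_eq_iff algebra_simps)
  ultimately show ?thesis by (simp only:)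
qed

lemma subgroup_wreath_subgroup: "subgroup (wreath_subgroup s M v) wreath_int"
proof (rule group.subgroupI[OF group_wreath_int])
  have "(0, 0 * int s) \<in> wreath_subgroup s M v"
    unfolding wreath_subgroup_iff[OF s] by (simp add: to_laurent_0 submodule_0[OF submodule_M])
  then show "wreath_subgroup s M v \<noteq> {}" by blast
next
  fix x assume "x \<in> wreath_subgroup s M v"
  then obtain f j where x: "x = (f, j * int s)" "to_laurent f - of_int j *s v \<in> M"
    using s by (rule wreath_subgroup_cases)
  \<comment> \<open>Modulo \<open>M\<close> the inverse has base component \<open>- f\<close>; the
    first term is the error made by ignoring the twist by \<open>x^(-j s)\<close>.\<close>
  have "- (Poly_Mapping.single (- j * int s) 1 *s to_laurent f - to_laurent f) - (to_laurent f - of_int j *s v) \<in> M"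
    by (rule submodule_diff[OF submodule_M submodule_uminus[OF submodule_M period_shift] x(2)])
  moreover have "- (Poly_Mapping.single (- j * int s) 1 *s to_laurent f - to_laurent f) - (to_laurent f - of_int j *s v)
      = to_laurent (- shift (- j * int s) f) - of_int (- j) *s v"
    by (simp add: to_laurent_simps vec_eq_iff)
  ultimately have "(- shift (- j * int s) f, - j * int s) \<in> wreath_subgroup s M v"
    by (simp only: wreath_subgroup_iff[OF s])
  then show "inv\<^bsub>wreath_int\<^esub> x \<in> wreath_subgroup s M v"
    by (simp add: x inv_wreath)
next
  fix x y assume "x \<in> wreath_subgroup s M v" "y \<in> wreath_subgroup s M v"
  then obtain f j g l where x: "x = (f, j * int s)" "to_laurent f - of_int j *s v \<in> M"
    and y: "y = (g, l * int s)" "to_laurent g - of_int l *s v \<in> M"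
    using s by (elim wreath_subgroup_cases) blast+
  have "(to_laurent f - of_int j *s v) + (Poly_Mapping.single (j * int s) 1 *s to_laurent g - to_laurent g)
      + (to_laurent g - of_int l *s v) \<in> M"
    by (rule submodule_add[OF submodule_M submodule_add[OF submodule_M x(2) period_shift] y(2)])
  moreover have "(to_laurent f - of_int j *s v) + (Poly_Mapping.single (j * int s) 1 *s to_laurent g - to_laurent g)
      + (to_laurent g - of_int l *s v) = to_laurent (f + shift (j * int s) g) - of_int (j + l) *s v"
    by (simp add: to_laurent_simps vec_eq_iff algebra_simps)
  ultimately have "(f + shift (j * int s) g, (j + l) * int s) \<in> wreath_subgroup s M v"
    by (simp only: wreath_subgroup_iff[OF s])
  then show "x \<otimes>\<^bsub>wreath_int\<^esub> y \<in> wreath_subgroup s M v"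
    by (simp add: x y mult_wreath algebra_simps)
qed (simp add: carrier_wreath)

lemma normal_wreath_subgroup: "wreath_subgroup s M v \<lhd> wreath_int"
  unfolding group.normal_inv_iff[OF group_wreath_int]
proof (intro conjI ballI subgroup_wreath_subgroup)
  fix x h :: "(int \<Rightarrow>\<^sub>0 'a ^ 'n) \<times> int" assume "h \<in> wreath_subgroup s M v"
  then obtain f j where h: "h = (f, j * int s)" "to_laurent f - of_int j *s v \<in> M"
    using s by (rule wreath_subgroup_cases)
  obtain g l where x: "x = (g, l)" by (cases x)
  \<comment> \<open>The three terms lie in \<open>M\<close> for three different reasons:
    \<open>M\<close> is a submodule, \<open>x^(j s)\<close> acts trivially modulo \<open>M\<close>,
    and \<open>x\<close> fixes \<open>v\<close> modulo \<open>M\<close>.\<close>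
  have "Poly_Mapping.single l 1 *s (to_laurent f - of_int j *s v)
      - (Poly_Mapping.single (j * int s) 1 *s to_laurent g - to_laurent g)
      + of_int j *s (Poly_Mapping.single l 1 *s v - v) \<in> M"
    by (rule submodule_add[OF submodule_M
          submodule_diff[OF submodule_M submodule_scale[OF submodule_M h(2)] period_shift]
          submodule_scale[OF submodule_M shift_representative]])
  moreover have "Poly_Mapping.single l 1 *s (to_laurent f - of_int j *s v)
      - (Poly_Mapping.single (j * int s) 1 *s to_laurent g - to_laurent g)
      + of_int j *s (Poly_Mapping.single l 1 *s v - v)
      = to_laurent (g + shift l f - shift (j * int s) g) - of_int j *s v"
    by (simp add: to_laurent_simps vec_eq_iff algebra_simps)
  ultimately have "(g + shift l f - shift (j * int s) g, j * int s) \<in> wreath_subgroup s M v"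
    by (simp only: wreath_subgroup_iff[OF s])
  then show "x \<otimes>\<^bsub>wreath_int\<^esub> h \<otimes>\<^bsub>wreath_int\<^esub> inv\<^bsub>wreath_int\<^esub> x \<in> wreath_subgroup s M v"
    by (simp only: x h conj_wreath)
qed

text \<open>A complete invariant of right cosets. Subtracting \<open>(k div s) v\<close> compensates
  for multiplication on the left by powers of \<open>(v, s)\<close>.\<close>

definition coset_label :: "(int \<Rightarrow>\<^sub>0 'a ^ 'n) \<times> int \<Rightarrow> int \<times> ('a laurent_poly ^ 'n) set"
  where "coset_label = (\<lambda>(f, k). (k mod int s, (to_laurent f - of_int (k div int s) *s v) +o M))"

lemma rcoset_eq_iff_label:
  "wreath_subgroup s M v #>\<^bsub>wreath_int\<^esub> x = wreath_subgroup s M v #>\<^bsub>wreath_int\<^esub> y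
    \<longleftrightarrow> coset_label x = coset_label y"
proof -
  let ?N = "wreath_subgroup s M v"
  interpret group "wreath_int :: ((int \<Rightarrow>\<^sub>0 'a ^ 'n) \<times> int) monoid" by (rule group_wreath_int)
  obtain f k g l where x: "x = (f, k)" and y: "y = (g, l)" by (cases x, cases y)
  have "?N #>\<^bsub>wreath_int\<^esub> x = ?N #>\<^bsub>wreath_int\<^esub> y \<longleftrightarrow> x \<otimes>\<^bsub>wreath_int\<^esub> inv\<^bsub>wreath_int\<^esub> y \<in> ?N"
    by (rule rcoset_eq_iff) (simp_all add: carrier_wreath subgroup_wreath_subgroup)
  also have "\<dots> \<longleftrightarrow> (f - shift (k - l) g, k - l) \<in> ?N"
    by (simp add: x y mult_inv_wreath)
  also have "\<dots> \<longleftrightarrow> coset_label x = coset_label y"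
  proof (cases "int s dvd k - l")
    case True
    then obtain j where j: "k - l = j * int s" by (metis dvdE mult.commute)
    then have k: "k = l + j * int s" by simp
    have mod: "k mod int s = l mod int s" and dv: "k div int s = l div int s + j"
      using s by (simp_all add: k)
    have "(f - shift (k - l) g, k - l) \<in> ?N \<longleftrightarrow> to_laurent (f - shift (j * int s) g) - of_int j *s v \<in> M"
      by (simp only: j wreath_subgroup_iff[OF s])
    also have "\<dots> \<longleftrightarrow> (to_laurent f - of_int (k div int s) *s v) - (to_laurent g - of_int (l div int s) *s v) \<in> M"
      (is "?A \<in> M \<longleftrightarrow> ?B \<in> M")
    proof -
      \<comment> \<open>Both sides involve the same \<open>f\<close> and multiples of
        \<open>v\<close>; what remains is the shift of \<open>g\<close> by a multiple of
        \<open>s\<close>, invisible modulo \<open>M\<close>.\<close>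
      have eq: "?B - ?A = Poly_Mapping.single (j * int s) 1 *s to_laurent g - to_laurent g"
        unfolding dv by (simp add: to_laurent_simps vec_eq_iff algebra_simps)
      have BA: "?B - ?A \<in> M" unfolding eq by (rule period_shift)
      show ?thesis using submodule_mem_cong[OF submodule_M BA] .
    qed
    also have "\<dots> \<longleftrightarrow> coset_label x = coset_label y"
      by (simp only: coset_label_def x y prod.case prod.inject mod coset_eq_iff[OF submodule_M] simp_thms)
    finally show ?thesis .
  next
    case False
    then have "k mod int s \<noteq> l mod int s" by (simp add: mod_eq_dvd_iff)
    then show ?thesis using False by (simp add: wreath_subgroup_def coset_label_def x y)
  qed
  finally show ?thesis .
qed

lemma range_coset_label: "range coset_label = {0..<int s} \<times> quot M"
proof (intro equalityI subsetI)
  fix z assume "z \<in> {0..<int s} \<times> quot M"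
  then obtain i w where z: "z = (i, w +o M)" "0 \<le> i" "i < int s" by (auto simp: quot_def)
  obtain f where "to_laurent f = w" using ex_to_laurent by blast
  then have "z = coset_label (f, i)" using z by (simp add: coset_label_def)
  then show "z \<in> range coset_label" by blast
qed (use s in \<open>auto simp: coset_label_def quot_def\<close>)

lemma rcosets_wreath_subgroup:
  "group_index wreath_int (wreath_subgroup s M v) = s * mod_index M"
  "finite (quot M) \<Longrightarrow> finite (rcosets\<^bsub>wreath_int\<^esub> (wreath_subgroup s M v))"
proof -
  let ?c = "\<lambda>x. wreath_subgroup s M v #>\<^bsub>wreath_int\<^esub> x"
  have R: "rcosets\<^bsub>wreath_int\<^esub> (wreath_subgroup s M v) = range ?c"
    by (auto simp: RCOSETS_def carrier_wreath)
  have "card (range ?c) = card (range coset_label)"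
    by (rule card_image_same_kernel) (rule rcoset_eq_iff_label)
  then show "group_index wreath_int (wreath_subgroup s M v) = s * mod_index M"
    by (simp add: group_index_def R range_coset_label card_cartesian_product mod_index_def)
  have "finite (range ?c) \<longleftrightarrow> finite (range coset_label)"
    by (rule finite_image_same_kernel) (rule rcoset_eq_iff_label)
  then show "finite (quot M) \<Longrightarrow> finite (rcosets\<^bsub>wreath_int\<^esub> (wreath_subgroup s M v))"
    by (simp add: R range_coset_label)
qed

end

section \<open>Classification of the normal subgroups of finite index\<close>

lemma wreath_subgroup_inject:
  assumes s: "s > 0" and s': "s' > 0" and M: "M \<in> submodules" and M': "M' \<in> submodules"
    and eq: "wreath_subgroup s M v = wreath_subgroup s' M' v'"
  shows "s = s'" "M = M'" "v - v' \<in> M"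
proof -
  \<comment> \<open>The element \<open>(u, t)\<close> lies in the subgroup, and all second
    components there are multiples of \<open>t'\<close>. By symmetry the two periods divide each
    other.\<close>
  have dvd: "t' dvd t" if t: "t > 0" and N: "N \<in> submodules"
    and eq: "wreath_subgroup t N u = wreath_subgroup t' N' u'"
    for t t' and N N' :: "('a laurent_poly ^ 'n) set" and u u'
  proof -
    obtain f where f: "to_laurent f = u" using ex_to_laurent by blast
    have "(f, 1 * int t) \<in> wreath_subgroup t N u"
      unfolding wreath_subgroup_iff[OF t] by (simp add: f submodule_0[OF N])
    then show ?thesis unfolding eq by (simp add: wreath_subgroup_def)
  qed
  show ss: "s = s'" using dvd[OF s M eq] dvd[OF s' M' eq[symmetric]] by (simp add: dvd_antisym)
  have "w \<in> M \<longleftrightarrow> w \<in> M'" for w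
  proof -
    obtain f where f: "to_laurent f = w" using ex_to_laurent by blast
    have "(f, 0 * int s) \<in> wreath_subgroup s M v \<longleftrightarrow> (f, 0 * int s) \<in> wreath_subgroup s M' v'"
      using eq ss by simp
    then show ?thesis unfolding wreath_subgroup_iff[OF s] by (simp add: f)
  qed
  then show MM: "M = M'" by blast
  obtain f where f: "to_laurent f = v" using ex_to_laurent by blast
  have "(f, 1 * int s) \<in> wreath_subgroup s M v"
    unfolding wreath_subgroup_iff[OF s] by (simp add: f submodule_0[OF M])
  then have "(f, 1 * int s) \<in> wreath_subgroup s M v'" using eq ss MM by simp
  then show "v - v' \<in> M" unfolding wreath_subgroup_iff[OF s] by (simp add: f)
qed

text \<open>When every constant is an integer multiple of 1, additive closure already gives closure
  under constants, and shifts then give all monomials. Over a proper extension of a prime field a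
  shift-invariant subgroup need not be a submodule.\<close>

lemma submodulesI_shift:
  fixes M :: "('a::comm_ring_1 laurent_poly ^ 'n) set"
  assumes scalars: "\<And>c :: 'a. \<exists>i::int. c = of_int i"
    and zero: "0 \<in> M" and diff: "\<And>v w. v \<in> M \<Longrightarrow> w \<in> M \<Longrightarrow> v - w \<in> M"
    and shift: "\<And>k v. v \<in> M \<Longrightarrow> Poly_Mapping.single k 1 *s v \<in> M"
  shows "M \<in> submodules"
proof -
  have uminus: "- v \<in> M" if "v \<in> M" for v using diff[OF zero that] by simp
  have add: "v + w \<in> M" if "v \<in> M" "w \<in> M" for v w
    using diff[OF that(1) uminus[OF that(2)]] by simp
  have int: "of_int i *s v \<in> M" if "v \<in> M" for i v
  proof (induction i rule: int_induct[of _ 0])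
    case base
    then show ?case using zero by simp
  next
    case (step1 i)
    have "of_int (i + 1) *s v = of_int i *s v + v" by (simp add: vec_eq_iff algebra_simps)
    then show ?case using add[OF step1(2) that] by (simp only:)
  next
    case (step2 i)
    have "of_int (i - 1) *s v = of_int i *s v - v" by (simp add: vec_eq_iff algebra_simps)
    then show ?case using diff[OF step2(2) that] by (simp only:)
  qed
  have scale: "c *s v \<in> M" if "v \<in> M" for c v
  proof (induction c rule: laurent_induct)
    case (single k c)
    obtain i where "c = of_int i" using scalars by blast
    then have "Poly_Mapping.single k c = of_int i * Poly_Mapping.single k 1"
      by (simp add: mult_single flip: single_of_int)
    then show ?case using int[OF shift[OF that]] by (simp add: vector_smult_assoc)
  next
    case (add f g)
    then show ?case using \<open>\<And>v w. v \<in> M \<Longrightarrow> w \<in> M \<Longrightarrow> v + w \<in> M\<close> by (simp add: vector_sadd_rdistrib)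
  qed
  show ?thesis using zero add scale by (auto simp: submodules_iff)
qed

lemma fin_index_normal_cases:
  fixes N :: "((int \<Rightarrow>\<^sub>0 'a::comm_ring_1 ^ 'n) \<times> int) set"
  assumes scalars: "\<And>c :: 'a. \<exists>i::int. c = of_int i" and N: "N \<in> fin_index_normal wreath_int"
  obtains s M v where "s > 0" "M \<in> submodules_above (1 - Poly_Mapping.single (int s) 1)"
    "(1 - laurent_X) *s v \<in> M" "N = wreath_subgroup s M v"
proof -
  let ?G = "wreath_int :: ((int \<Rightarrow>\<^sub>0 'a ^ 'n) \<times> int) monoid"
  interpret group ?G by (rule group_wreath_int)
  have normal: "N \<lhd> ?G" and fin: "finite (rcosets\<^bsub>?G\<^esub> N)"
    using N by (simp_all add: fin_index_normal_def)
  then have sub: "subgroup N ?G" by (simp add: normal_inv_iff)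
  have mult: "x \<otimes>\<^bsub>?G\<^esub> y \<in> N" if "x \<in> N" "y \<in> N" for x y
    using subgroup.m_closed[OF sub that] .
  have mult_inv: "(f - shift (k - l) g, k - l) \<in> N" if "(f, k) \<in> N" "(g, l) \<in> N" for f k g l
    using mult[OF that(1) subgroup.m_inv_closed[OF sub that(2)]] by (simp add: mult_inv_wreath)
  have conj: "(g + shift l f - shift k g, k) \<in> N" if "(f, k) \<in> N" for f k g l
    using normal that unfolding normal_inv_iff conj_wreath[symmetric] by (simp add: carrier_wreath)
  have one: "(0, 0) \<in> N" using subgroup.one_closed[OF sub] by (simp add: one_wreath)

  have "\<exists>t>0. \<exists>f. (f, int t) \<in> N"
  proof -
    \<comment> \<open>Pigeonhole: the elements \<open>(0, i)\<close> fall into finitely many cosets,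
      and two of them in one coset differ by an element of \<open>N\<close> with nonzero second
      component.\<close>
    let ?c = "\<lambda>i::nat. N #>\<^bsub>?G\<^esub> (0, int i)"
    have "range ?c \<subseteq> rcosets\<^bsub>?G\<^esub> N" by (auto simp: RCOSETS_def carrier_wreath)
    then have "finite (range ?c)" using fin finite_subset by blast
    then have "\<not> inj ?c" using finite_imageD by blast
    then obtain i j where "i \<noteq> j" "?c i = ?c j" by (auto simp: inj_def)
    then obtain i j where ij: "j < i" "?c i = ?c j" by (metis linorder_neqE_nat)
    then have "(0 - shift (int i - int j) 0, int i - int j) \<in> N"
      using rcoset_eq_iff[OF sub, of "(0, int i)" "(0, int j)"] by (simp add: carrier_wreath mult_inv_wreath)
    then show ?thesis using ij(1) by (intro exI[of _ "i - j"]) (auto simp: of_nat_diff)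
  qed
  \<comment> \<open>The least positive second component generates the projection of \<open>N\<close>
    to the integers.\<close>
  define s where "s = (LEAST t. t > 0 \<and> (\<exists>f. (f, int t) \<in> N))"
  have s: "s > 0" and "\<exists>f. (f, int s) \<in> N"
    using LeastI_ex[OF \<open>\<exists>t>0. \<exists>f. (f, int t) \<in> N\<close>] by (auto simp: s_def)
  then obtain f0 where f0: "(f0, int s) \<in> N" by blast
  have least: "k = 0" if "(f, k) \<in> N" "0 \<le> k" "k < int s" for f k
  proof (rule ccontr)
    assume "k \<noteq> 0"
    then have "nat k > 0 \<and> (\<exists>f. (f, int (nat k)) \<in> N)" using that by auto
    then have "s \<le> nat k" unfolding s_def by (rule Least_le)
    then show False using that by simp
  qed
  define M where "M = to_laurent ` {f. (f, 0) \<in> N}"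
  have M_iff: "to_laurent f \<in> M \<longleftrightarrow> (f, 0) \<in> N" for f
    using bij_to_laurent by (auto simp: M_def bij_def inj_def)
  have M_sub: "M \<in> submodules"
  proof (rule submodulesI_shift[OF scalars])
    show "0 \<in> M" using M_iff[of 0] one by (simp add: to_laurent_0)
  next
    fix v w assume "v \<in> M" "w \<in> M"
    then obtain f g where fg: "v = to_laurent f" "(f, 0) \<in> N" "w = to_laurent g" "(g, 0) \<in> N"
      by (auto simp: M_def)
    show "v - w \<in> M"
      using mult_inv[OF fg(2) fg(4)] by (simp add: fg(1,3) M_iff shift_by_0 flip: to_laurent_diff)
  next
    fix k v assume "v \<in> M"
    then obtain f where f: "v = to_laurent f" "(f, 0) \<in> N" by (auto simp: M_def)
    show "Poly_Mapping.single k 1 *s v \<in> M"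
      using conj[OF f(2), of 0 k] by (simp add: f(1) M_iff shift_by_0 flip: to_laurent_shift)
  qed
  have M: "M \<in> submodules_above (1 - Poly_Mapping.single (int s) 1)"
    unfolding submodules_above_iff
  proof (intro conjI allI M_sub)
    fix w :: "'a laurent_poly ^ 'n"
    obtain g where g: "w = to_laurent g" using ex_to_laurent by metis
    \<comment> \<open>The commutator of \<open>(g, 0)\<close> with \<open>(f0, s)\<close> has second
      component 0, so it lands in the base group.\<close>
    from mult_inv[OF conj[OF f0, of g 0] f0] have "(g - shift (int s) g, 0) \<in> N"
      by (simp add: shift_by_0)
    then have "to_laurent (g - shift (int s) g) \<in> M" by (simp only: M_iff)
    moreover have "to_laurent (g - shift (int s) g) = (1 - Poly_Mapping.single (int s) 1) *s w"
      by (simp add: g to_laurent_simps vec_eq_iff algebra_simps)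
    ultimately show "(1 - Poly_Mapping.single (int s) 1) *s w \<in> M" by (simp only:)
  qed
  define v where "v = to_laurent f0"
  have v: "(1 - laurent_X) *s v \<in> M"
  proof -
    \<comment> \<open>Conjugation by the generator replaces \<open>f0\<close> by \<open>x f0\<close>
      over the same \<open>s\<close>; the quotient of the two elements lies in the base
      group.\<close>
    from mult_inv[OF f0 conj[OF f0, of 0 1]] have "(f0 - shift 1 f0, 0) \<in> N"
      by (simp add: shift_by_0 shift_0)
    then have "to_laurent (f0 - shift 1 f0) \<in> M" by (simp only: M_iff)
    moreover have "to_laurent (f0 - shift 1 f0) = (1 - laurent_X) *s v"
      by (simp add: v_def laurent_X_def to_laurent_simps vec_eq_iff algebra_simps)
    ultimately show ?thesis by (simp only:)
  qed
  note period = period_shift[OF s M v]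
  \<comment> \<open>A reference element of \<open>N\<close> over each multiple of \<open>s\<close>,
    in essence a power of \<open>(f0, s)\<close>. Both inclusions below compare an arbitrary element
    with it. The induction runs in both directions to reach negative \<open>j\<close>.\<close>
  have ex: "\<exists>h. (h, j * int s) \<in> N \<and> to_laurent h - of_int j *s v \<in> M" for j
  proof (induction j rule: int_induct[of _ 0])
    case base
    have "(0, 0 * int s) \<in> N \<and> to_laurent 0 - of_int 0 *s v \<in> M"
      using one submodule_0[OF M_sub] by (simp add: to_laurent_0)
    then show ?case by blast
  next
    case (step1 i)
    then obtain h where h: "(h, i * int s) \<in> N" "to_laurent h - of_int i *s v \<in> M" by blast
    have "(h + shift (i * int s) f0, (i + 1) * int s) \<in> N"
      using mult[OF h(1) f0] by (simp add: mult_wreath algebra_simps)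
    moreover have "to_laurent (h + shift (i * int s) f0) - of_int (i + 1) *s v =
        (to_laurent h - of_int i *s v) + (Poly_Mapping.single (i * int s) 1 *s v - v)"
      by (simp add: v_def to_laurent_simps vec_eq_iff algebra_simps)
    moreover have "(to_laurent h - of_int i *s v) + (Poly_Mapping.single (i * int s) 1 *s v - v) \<in> M"
      by (rule submodule_add[OF M_sub h(2) period])
    ultimately show ?case by metis
  next
    case (step2 i)
    then obtain h where h: "(h, i * int s) \<in> N" "to_laurent h - of_int i *s v \<in> M" by blast
    have "(h - shift ((i - 1) * int s) f0, (i - 1) * int s) \<in> N"
      using mult_inv[OF h(1) f0] by (simp add: algebra_simps)
    moreover have "to_laurent (h - shift ((i - 1) * int s) f0) - of_int (i - 1) *s v =
        (to_laurent h - of_int i *s v) - (Poly_Mapping.single ((i - 1) * int s) 1 *s v - v)"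
      by (simp add: v_def to_laurent_simps vec_eq_iff algebra_simps)
    moreover have "(to_laurent h - of_int i *s v) - (Poly_Mapping.single ((i - 1) * int s) 1 *s v - v) \<in> M"
      by (rule submodule_diff[OF M_sub h(2) period])
    ultimately show ?case by metis
  qed
  have "(f, k) \<in> N \<longleftrightarrow> (f, k) \<in> wreath_subgroup s M v" for f k
  proof
    assume fk: "(f, k) \<in> N"
    define j where "j = k div int s"
    obtain h where h: "(h, j * int s) \<in> N" "to_laurent h - of_int j *s v \<in> M" using ex by blast
    \<comment> \<open>Dividing by the reference element leaves the remainder of \<open>k\<close>
      modulo \<open>s\<close>, which is 0 by minimality of \<open>s\<close>.\<close>
    have "k - j * int s = k mod int s" by (simp add: j_def minus_div_mult_eq_mod)
    then have "k - j * int s = 0" using least[OF mult_inv[OF fk h(1)]] s by simp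
    then have k: "k = j * int s" by simp
    have "(f - h, 0) \<in> N" using mult_inv[OF fk h(1)] by (simp add: k shift_by_0)
    then have "to_laurent (f - h) \<in> M" by (simp only: M_iff)
    from submodule_add[OF M_sub this h(2)] have "to_laurent f - of_int j *s v \<in> M"
      by (simp add: to_laurent_diff)
    then show "(f, k) \<in> wreath_subgroup s M v" by (simp only: k wreath_subgroup_iff[OF s])
  next
    assume "(f, k) \<in> wreath_subgroup s M v"
    then obtain j where k: "k = j * int s" and f: "to_laurent f - of_int j *s v \<in> M"
      using s by (elim wreath_subgroup_cases) auto
    obtain h where h: "(h, j * int s) \<in> N" "to_laurent h - of_int j *s v \<in> M" using ex by blast
    from submodule_diff[OF M_sub f h(2)] have "to_laurent (f - h) \<in> M"
      by (simp add: to_laurent_diff)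
    then have "(f - h, 0) \<in> N" by (simp only: M_iff)
    from mult[OF this h(1)] show "(f, k) \<in> N" by (simp add: mult_wreath shift_by_0 k)
  qed
  then have "N = wreath_subgroup s M v" by auto
  with s M v that show ?thesis by blast
qed

text \<open>Recording the coset of \<open>v\<close> instead of \<open>v\<close> itself makes the
  parametrization injective and gives \<open>tau M\<close> choices for each
  \<open>M\<close>.\<close>

definition subgroup_data :: "nat \<Rightarrow> (('a::comm_ring_1 laurent_poly ^ 'n) set \<times> ('a laurent_poly ^ 'n) set) set"
  where "subgroup_data s = (SIGMA M : submodules_above (1 - laurent_X ^ s).
    {C \<in> quot M. quot_mult M (1 - laurent_X) C = M})"

definition subgroup_of_data ::
    "nat \<times> ('a::comm_ring_1 laurent_poly ^ 'n) set \<times> ('a laurent_poly ^ 'n) set \<Rightarrow> ((int \<Rightarrow>\<^sub>0 'a ^ 'n) \<times> int) set"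
  where "subgroup_of_data = (\<lambda>(s, M, C). wreath_subgroup s M (SOME v. v \<in> C))"

lemma subgroup_data_cases:
  assumes "(M, C) \<in> subgroup_data s"
  obtains v where "M \<in> submodules_above (1 - Poly_Mapping.single (int s) 1)"
    "(1 - laurent_X) *s v \<in> M" "C = v +o M" "subgroup_of_data (s, M, C) = wreath_subgroup s M v"
proof -
  have M: "M \<in> submodules_above (1 - Poly_Mapping.single (int s) 1)"
    and C: "C \<in> cosets {v. (1 - laurent_X) *s v \<in> M} M"
    using assms quot_mult_kernel[of M "1 - laurent_X"]
    by (auto simp: subgroup_data_def laurent_X_power submodules_above_def)
  have sub: "M \<in> submodules" using M by (simp only: submodules_above_iff)
  obtain w where w: "(1 - laurent_X) *s w \<in> M" "C = w +o M" using C unfolding cosets_def by blast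
  define v where "v = (SOME v. v \<in> C)"
  have "w \<in> C" by (simp add: w(2) mem_coset_iff submodule_0[OF sub])
  then have "v \<in> C" unfolding v_def by (rule someI)
  then have vw: "v - w \<in> M" by (simp add: w(2) mem_coset_iff)
  have "(1 - laurent_X) *s (v - w) + (1 - laurent_X) *s w \<in> M"
    by (rule submodule_add[OF sub submodule_scale[OF sub vw] w(1)])
  moreover have "(1 - laurent_X) *s (v - w) + (1 - laurent_X) *s w = (1 - laurent_X) *s v"
    by (simp add: vec_eq_iff algebra_simps)
  ultimately have "(1 - laurent_X) *s v \<in> M" by (simp only:)
  moreover have "C = v +o M" using vw by (simp add: w(2) coset_eq_iff[OF sub] submodule_diff_commute[OF sub])
  ultimately show ?thesis by (rule that[OF M]) (simp add: subgroup_of_data_def v_def)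
qed

lemma subgroup_of_data_index:
  assumes "(M, C) \<in> subgroup_data s" "s > 0"
  shows "group_index wreath_int (subgroup_of_data (s, M, C)) = s * mod_index M"
  using assms(1)
proof (rule subgroup_data_cases)
  fix v assume "M \<in> submodules_above (1 - Poly_Mapping.single (int s) 1)"
    "(1 - laurent_X) *s v \<in> M" "C = v +o M" "subgroup_of_data (s, M, C) = wreath_subgroup s M v"
  then show ?thesis using rcosets_wreath_subgroup(1)[OF assms(2)] by metis
qed

lemma bij_betw_subgroup_of_data:
  assumes scalars: "\<And>c :: 'a::{finite, comm_ring_1}. \<exists>i::int. c = of_int i"
  shows "bij_betw subgroup_of_data (Sigma {1..} subgroup_data)
    (fin_index_normal (wreath_int :: ((int \<Rightarrow>\<^sub>0 'a ^ 'n) \<times> int) monoid))"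
  unfolding bij_betw_def
proof (intro conjI inj_onI equalityI subsetI)
  fix x y :: "nat \<times> ('a laurent_poly ^ 'n) set \<times> ('a laurent_poly ^ 'n) set"
  assume x: "x \<in> Sigma {1..} subgroup_data" and y: "y \<in> Sigma {1..} subgroup_data"
    and eq: "subgroup_of_data x = subgroup_of_data y"
  obtain s M C where xs: "x = (s, M, C)" "s > 0" "(M, C) \<in> subgroup_data s" using x by (cases x) auto
  obtain t N D where yt: "y = (t, N, D)" "t > 0" "(N, D) \<in> subgroup_data t" using y by (cases y) auto
  obtain v where v: "M \<in> submodules_above (1 - Poly_Mapping.single (int s) 1)"
    "C = v +o M" "subgroup_of_data x = wreath_subgroup s M v"
    using subgroup_data_cases[OF xs(3)] xs(1) by metis
  obtain w where w: "N \<in> submodules_above (1 - Poly_Mapping.single (int t) 1)"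
    "D = w +o N" "subgroup_of_data y = wreath_subgroup t N w"
    using subgroup_data_cases[OF yt(3)] yt(1) by metis
  have sub: "M \<in> submodules" "N \<in> submodules" using v(1) w(1) by (simp_all only: submodules_above_iff)
  note inject = wreath_subgroup_inject[OF xs(2) yt(2) sub eq[unfolded v(3) w(3)]]
  then have "C = D" using v(2) w(2) coset_eq_iff[OF sub(1)] by metis
  then show "x = y" using inject(1,2) xs(1) yt(1) by simp
next
  fix N :: "((int \<Rightarrow>\<^sub>0 'a ^ 'n) \<times> int) set" assume "N \<in> subgroup_of_data ` Sigma {1..} subgroup_data"
  then obtain s M C where *: "N = subgroup_of_data (s, M, C)" "s > 0" "(M, C) \<in> subgroup_data s" by auto
  obtain v where v: "M \<in> submodules_above (1 - Poly_Mapping.single (int s) 1)"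
    "(1 - laurent_X) *s v \<in> M" "N = wreath_subgroup s M v"
    using subgroup_data_cases[OF *(3)] *(1) by metis
  have "finite (quot M)" using finite_quot[OF _ v(1)] *(2) by simp
  then show "N \<in> fin_index_normal wreath_int"
    using rcosets_wreath_subgroup(2)[OF *(2) v(1,2)] normal_wreath_subgroup[OF *(2) v(1,2)]
    by (simp add: fin_index_normal_def v(3))
next
  fix N :: "((int \<Rightarrow>\<^sub>0 'a ^ 'n) \<times> int) set" assume "N \<in> fin_index_normal wreath_int"
  then obtain s M v where s: "s > 0" and M: "M \<in> submodules_above (1 - Poly_Mapping.single (int s) 1)"
    and v: "(1 - laurent_X) *s v \<in> M" and N: "N = wreath_subgroup s M v"
    by (rule fin_index_normal_cases[OF scalars])
  have sub: "M \<in> submodules" using M by (simp only: submodules_above_iff)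
  have mem: "(M, v +o M) \<in> subgroup_data s"
    unfolding subgroup_data_def laurent_X_power quot_mult_kernel[OF sub] mem_Sigma_iff
    using M v quot_mult_kernel[OF sub, of "1 - laurent_X"] by (auto simp: cosets_def)
  obtain w where w: "(1 - laurent_X) *s w \<in> M" "v +o M = w +o M"
    "subgroup_of_data (s, M, v +o M) = wreath_subgroup s M w"
    using subgroup_data_cases[OF mem] by metis
  \<comment> \<open>The representative picked from the coset may differ from \<open>v\<close>, but
    only by an element of \<open>M\<close>, which does not change the subgroup.\<close>
  have "wreath_subgroup s M w = wreath_subgroup s M v"
  proof -
    have vw: "w - v \<in> M" using w(2) coset_eq_iff[OF sub] by metis
    have "to_laurent f - of_int j *s w \<in> M \<longleftrightarrow> to_laurent f - of_int j *s v \<in> M" for f j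
    proof (rule submodule_mem_cong[OF sub])
      have "(to_laurent f - of_int j *s v) - (to_laurent f - of_int j *s w) = of_int j *s (w - v)"
        by (simp add: vec_eq_iff algebra_simps)
      then show "(to_laurent f - of_int j *s v) - (to_laurent f - of_int j *s w) \<in> M"
        using submodule_scale[OF sub vw] by (simp only:)
    qed
    then show ?thesis by (simp only: wreath_subgroup_def)
  qed
  then have "N = subgroup_of_data (s, M, v +o M)" using w(3) N by simp
  then show "N \<in> subgroup_of_data ` Sigma {1..} subgroup_data" using mem s by force
qed

section \<open>Summation\<close>

lemma ds_coeff_0: "ds_coeff F 0 = 0"
  using ds_coeff[of F] by simp

lemma ds_coeff_sum: "ds_coeff (sum F A) m = (\<Sum>i\<in>A. ds_coeff (F i) m)"
  by (induction A rule: infinite_finite_induct)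
    (simp_all add: plus_dirichlet_series.rep_eq zero_dirichlet_series.rep_eq)

lemma ds_coeff_ds_term: "ds_coeff (ds_term k) m = (if m = k \<and> m \<noteq> 0 then 1 else 0)"
  by (simp add: ds_term.rep_eq)

lemma ds_has_sum_reindex:
  assumes h: "bij_betw h A B" and F: "ds_has_sum (\<lambda>x. F (h x)) A S"
  shows "ds_has_sum F B S"
  unfolding ds_has_sum_def
proof (intro allI conjI)
  fix m
  have bij: "bij_betw h {x \<in> A. ds_coeff (F (h x)) m \<noteq> 0} {y \<in> B. ds_coeff (F y) m \<noteq> 0}"
    using h by (auto simp: bij_betw_def inj_on_def)
  show "finite {y \<in> B. ds_coeff (F y) m \<noteq> 0}"
    using F bij_betw_finite[OF bij] by (simp add: ds_has_sum_def)
  show "ds_coeff S m = (\<Sum>y | y \<in> B \<and> ds_coeff (F y) m \<noteq> 0. ds_coeff (F y) m)"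
    using F sum.reindex_bij_betw[OF bij, of "\<lambda>y. ds_coeff (F y) m"] by (simp add: ds_has_sum_def)
qed

text \<open>A formal Fubini rule. The family over pairs has finite support at each \<open>m\<close>,
  so its coefficientwise sum exists and may be regrouped by the first index.\<close>

lemma ds_has_sum_Sigma:
  fixes G :: "'i \<times> 'j \<Rightarrow> 'a::comm_semiring_1 dirichlet_series"
  assumes J: "\<And>i. i \<in> I \<Longrightarrow> finite (J i)"
    and fin: "\<And>m. finite {x \<in> Sigma I J. ds_coeff (G x) m \<noteq> 0}"
  shows "\<exists>S. ds_has_sum G (Sigma I J) S \<and> ds_has_sum (\<lambda>i. \<Sum>j\<in>J i. G (i, j)) I S"
proof -
  define A where "A m = {x \<in> Sigma I J. ds_coeff (G x) m \<noteq> 0}" for m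
  define S where "S = Abs_ds (\<lambda>m. \<Sum>x\<in>A m. ds_coeff (G x) m)"
  \<comment> \<open>\<open>Abs_ds\<close> requires the value 0 at \<open>m = 0\<close>, which holds
    since every summand has it.\<close>
  have S: "ds_coeff S m = (\<Sum>x\<in>A m. ds_coeff (G x) m)" for m
    unfolding S_def by (subst Abs_ds_inverse) (auto simp: ds_coeff_0)
  let ?F = "\<lambda>i. \<Sum>j\<in>J i. G (i, j)"
  have F: "ds_coeff (?F i) m = (\<Sum>j | (i, j) \<in> A m. ds_coeff (G (i, j)) m)" if "i \<in> I" for i m
    unfolding ds_coeff_sum using J[OF that] that
    by (intro sum.mono_neutral_right) (auto simp: A_def)
  have "finite {i \<in> I. ds_coeff (?F i) m \<noteq> 0} \<and>
      ds_coeff S m = (\<Sum>i | i \<in> I \<and> ds_coeff (?F i) m \<noteq> 0. ds_coeff (?F i) m)" for m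
  proof -
    have fA: "finite (fst ` A m)" using fin by (simp add: A_def)
    have AI: "fst ` A m \<subseteq> I" by (auto simp: A_def)
    \<comment> \<open>Only an inclusion: inner sums may cancel, so an index of the large family can
      drop out of the support of the grouped one.\<close>
    have ss: "{i \<in> I. ds_coeff (?F i) m \<noteq> 0} \<subseteq> fst ` A m"
    proof
      fix i assume i: "i \<in> {i \<in> I. ds_coeff (?F i) m \<noteq> 0}"
      then have "(\<Sum>j | (i, j) \<in> A m. ds_coeff (G (i, j)) m) \<noteq> 0" using F[of i m] by auto
      then have "{j. (i, j) \<in> A m} \<noteq> {}" by (metis sum.empty)
      then show "i \<in> fst ` A m" by force
    qed
    have "ds_coeff S m = (\<Sum>(i, j)\<in>Sigma (fst ` A m) (\<lambda>i. {j. (i, j) \<in> A m}). ds_coeff (G (i, j)) m)"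
      unfolding S by (rule sum.cong) force+
    also have "\<dots> = (\<Sum>i\<in>fst ` A m. \<Sum>j | (i, j) \<in> A m. ds_coeff (G (i, j)) m)"
    proof (rule sum.Sigma[symmetric, OF fA], intro ballI)
      fix i assume "i \<in> fst ` A m"
      then have "finite (J i)" using J AI by blast
      moreover have "{j. (i, j) \<in> A m} \<subseteq> J i" by (auto simp: A_def)
      ultimately show "finite {j. (i, j) \<in> A m}" by (rule rev_finite_subset)
    qed
    also have "\<dots> = (\<Sum>i\<in>fst ` A m. ds_coeff (?F i) m)"
      using AI by (intro sum.cong refl F[symmetric]) blast
    also have "\<dots> = (\<Sum>i | i \<in> I \<and> ds_coeff (?F i) m \<noteq> 0. ds_coeff (?F i) m)"
      by (rule sum.mono_neutral_right[OF fA ss]) (use AI in auto)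
    finally show ?thesis using finite_subset[OF ss fA] by simp
  qed
  then have "ds_has_sum ?F I S" by (simp add: ds_has_sum_def)
  moreover have "ds_has_sum G (Sigma I J) S"
    unfolding ds_has_sum_def using fin S by (simp add: A_def)
  ultimately show ?thesis by blast
qed

section \<open>Summing over the parametrized subgroups\<close>

lemma finite_subgroup_data:
  assumes "s > 0"
  shows "finite (subgroup_data s :: (('a::{finite, comm_ring_1} laurent_poly ^ 'n) set \<times> _) set)"
  unfolding subgroup_data_def laurent_X_power
proof (rule finite_SigmaI)
  show "finite (submodules_above (1 - Poly_Mapping.single (int s) 1) :: ('a laurent_poly ^ 'n) set set)"
    using assms by (intro finite_submodules_above) simp
  fix M :: "('a laurent_poly ^ 'n) set"
  assume "M \<in> submodules_above (1 - Poly_Mapping.single (int s) 1)"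
  then have "finite (quot M)" using assms finite_quot[of "int s" M] by simp
  then show "finite {C \<in> quot M. quot_mult M (1 - laurent_X) C = M}" by simp
qed

lemma sum_subgroup_data:
  assumes "s > 0"
  shows "(\<Sum>(M, C)\<in>(subgroup_data s :: (('a::{finite, comm_ring_1} laurent_poly ^ 'n) set \<times> _) set).
      ds_term (s * mod_index M)) =
    ds_term s * sum weighted_term (submodules_above (1 - laurent_X ^ s) :: ('a laurent_poly ^ 'n) set set)"
proof -
  let ?T = "submodules_above (1 - laurent_X ^ s) :: ('a laurent_poly ^ 'n) set set"
  let ?K = "\<lambda>M :: ('a laurent_poly ^ 'n) set. {C \<in> quot M. quot_mult M (1 - laurent_X) C = M}"
  have T: "finite ?T" unfolding laurent_X_power using assms by (intro finite_submodules_above) simp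
  have K: "finite (?K M)" if "M \<in> ?T" for M
    using that assms finite_quot[of "int s" M] by (simp add: laurent_X_power)
  have "(\<Sum>(M, C)\<in>(subgroup_data s :: (('a laurent_poly ^ 'n) set \<times> _) set). ds_term (s * mod_index M)) =
      (\<Sum>M\<in>?T. \<Sum>C\<in>?K M. ds_term (s * mod_index M) :: nat dirichlet_series)"
    unfolding subgroup_data_def using T K by (intro sum.Sigma[symmetric]) auto
  \<comment> \<open>The summand is the same for all cosets \<open>C\<close>, so the inner sum
    contributes the factor \<open>tau M\<close>.\<close>
  also have "\<dots> = (\<Sum>M\<in>?T. ds_term s * weighted_term M)"
    by (rule sum.cong) (simp_all add: weighted_term_def tau_def mult_ac flip: ds_term_mult)
  finally show ?thesis by (simp add: sum_distrib_left)
qed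

lemma normal_zeta_wreath:
  assumes scalars: "\<And>c :: 'a::{finite, comm_ring_1}. \<exists>i::int. c = of_int i"
  shows "\<exists>S. ds_has_sum (\<lambda>N. ds_term (group_index wreath_int N))
      (fin_index_normal (wreath_int :: ((int \<Rightarrow>\<^sub>0 'a ^ 'n) \<times> int) monoid)) S \<and>
    ds_has_sum (\<lambda>s. ds_term s * sum weighted_term
      (submodules_above (1 - laurent_X ^ s) :: ('a laurent_poly ^ 'n) set set)) {1..} S"
proof -
  let ?L = "wreath_int :: ((int \<Rightarrow>\<^sub>0 'a ^ 'n) \<times> int) monoid"
  let ?J = "subgroup_data :: nat \<Rightarrow> (('a laurent_poly ^ 'n) set \<times> ('a laurent_poly ^ 'n) set) set"
  let ?G = "\<lambda>(s, M, C). ds_term (s * mod_index M) :: nat dirichlet_series"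
  have fin: "finite {x \<in> Sigma {1..} ?J. ds_coeff (?G x) m \<noteq> 0}" for m
  proof (rule finite_subset)
    \<comment> \<open>The term at \<open>(s, M, C)\<close> contributes to \<open>m\<close> only if
      \<open>s\<close> times the index equals \<open>m > 0\<close>, which bounds \<open>s\<close> by
      \<open>m\<close>.\<close>
    show "{x \<in> Sigma {1..} ?J. ds_coeff (?G x) m \<noteq> 0} \<subseteq> Sigma {1..m} ?J"
      by (auto simp: ds_coeff_ds_term split: if_splits)
    show "finite (Sigma {1..m} ?J)" by (rule finite_SigmaI) (auto simp: finite_subgroup_data)
  qed
  obtain S where S: "ds_has_sum ?G (Sigma {1..} ?J) S" "ds_has_sum (\<lambda>s. \<Sum>j\<in>?J s. ?G (s, j)) {1..} S"
    using ds_has_sum_Sigma[OF _ fin] finite_subgroup_data by (metis (no_types, lifting) One_nat_def Suc_le_lessD atLeast_iff)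
  have "ds_has_sum (\<lambda>x. ds_term (group_index ?L (subgroup_of_data x))) (Sigma {1..} ?J) S"
  proof -
    have "ds_term (group_index ?L (subgroup_of_data x)) = ?G x" if "x \<in> Sigma {1..} ?J" for x
      using that by (cases x) (auto simp: subgroup_of_data_index Suc_le_eq)
    then show ?thesis using S(1) unfolding ds_has_sum_def by (simp cong: conj_cong)
  qed
  from ds_has_sum_reindex[OF bij_betw_subgroup_of_data[OF scalars] this]
  have "ds_has_sum (\<lambda>N. ds_term (group_index ?L N)) (fin_index_normal ?L) S" .
  moreover have "ds_has_sum (\<lambda>s. ds_term s * sum weighted_term
      (submodules_above (1 - laurent_X ^ s) :: ('a laurent_poly ^ 'n) set set)) {1..} S"
  proof -
    have "(\<Sum>j\<in>?J s. ?G (s, j)) = ds_term s * sum weighted_term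
      (submodules_above (1 - laurent_X ^ s) :: ('a laurent_poly ^ 'n) set set)" if "s \<in> {1..}" for s
      using that sum_subgroup_data[of s, where 'a = 'a and 'n = 'n] by (simp add: case_prod_unfold)
    then show ?thesis using S(2) unfolding ds_has_sum_def by (simp cong: conj_cong)
  qed
  ultimately show ?thesis by blast
qed

theorem theorem3p17:
  shows
    "let L = (lamplighter :: ((int \<Rightarrow>\<^sub>0 'p::prime_card mod_ring ^ 'n::finite) \<times> int) monoid);
         x = (laurent_X :: 'p mod_ring laurent_poly);
         F = (\<lambda>s::nat. ds_term s *
           (\<Prod>r | r \<in> normalized_primes \<and> r dvd 1 - x ^ s \<and> r \<noteq> 1 - x.
             \<Sum>M | M \<in> (Mod_at r :: ('p mod_ring laurent_poly ^ 'n) set set) \<and> range ((*s) (1 - x ^ s)) \<subseteq> M.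
               ds_term (mod_index M)) *
           (\<Sum>M | M \<in> (Mod_at (1 - x) :: ('p mod_ring laurent_poly ^ 'n) set set) \<and> range ((*s) (1 - x ^ s)) \<subseteq> M.
             of_nat (tau M) * ds_term (mod_index M)))
     in ds_summable (\<lambda>N. ds_term (group_index L N) :: nat dirichlet_series) (fin_index_normal L) \<and>
        ds_summable F {1..} \<and>
        normal_zeta L = ds_infsum F {1..}"
proof -
  let ?x = "laurent_X :: 'p mod_ring laurent_poly"
  let ?L = "lamplighter :: ((int \<Rightarrow>\<^sub>0 'p mod_ring ^ 'n) \<times> int) monoid"
  let ?F = "\<lambda>s::nat. ds_term s *
    (\<Prod>r | r \<in> normalized_primes \<and> r dvd 1 - ?x ^ s \<and> r \<noteq> 1 - ?x.
      \<Sum>M | M \<in> (Mod_at r :: ('p mod_ring laurent_poly ^ 'n) set set) \<and> range ((*s) (1 - ?x ^ s)) \<subseteq> M.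
        ds_term (mod_index M)) *
    (\<Sum>M | M \<in> (Mod_at (1 - ?x) :: ('p mod_ring laurent_poly ^ 'n) set set) \<and> range ((*s) (1 - ?x ^ s)) \<subseteq> M.
      of_nat (tau M) * ds_term (mod_index M)) :: nat dirichlet_series"
  \<comment> \<open>Each residue class is the image of its integer representative.\<close>
  have scalars: "\<exists>i::int. c = of_int i" for c :: "'p mod_ring"
    by (rule exI[of _ "to_int_mod_ring c"]) (simp add: of_int_of_int_mod_ring)
  obtain S where S: "ds_has_sum (\<lambda>N. ds_term (group_index ?L N)) (fin_index_normal ?L) S"
    and S': "ds_has_sum (\<lambda>s. ds_term s * sum weighted_term
      (submodules_above (1 - ?x ^ s) :: ('p mod_ring laurent_poly ^ 'n) set set)) {1..} S"
    using normal_zeta_wreath[OF scalars] by blast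
  have "ds_term s * sum weighted_term
      (submodules_above (1 - ?x ^ s) :: ('p mod_ring laurent_poly ^ 'n) set set) = ?F s"
    if "s \<in> {1..}" for s
  proof -
    have nz: "1 - ?x ^ s \<noteq> 0" unfolding laurent_X_power using that by (intro one_minus_single_nonzero) auto
    have dv: "1 - ?x dvd 1 - ?x ^ s"
      using one_minus_single_dvd[of 1 "int s"] by (simp add: laurent_X_power) (simp add: laurent_X_def)
    show ?thesis unfolding sum_weighted_term_factorization[OF nz dv] mult.assoc ..
  qed
  then have F: "ds_has_sum ?F {1..} S"
    using S' unfolding ds_has_sum_def by (simp cong: conj_cong)
  show ?thesis
    unfolding Let_def normal_zeta_def ds_summable_def ds_infsum_eqI[OF S] ds_infsum_eqI[OF F]
    by (intro conjI exI[of _ S] S F refl)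
qed

end
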